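(* Let $a,d\in\mathbb{Z}$ with $ad\neq 0$, and let $f(x)=x^4+ax^3+d$. If $f(x)$ is monogenic, then $\mathrm{Gal}(f)\not\simeq C_2\times C_2$ and $\mathrm{Gal}(f)\not\simeq C_4$.
   Context: A monic polynomial $f(x)\in\mathbb{Z}[x]$ of degree 4 is called monogenic if $f(x)$ is irreducible over $\mathbb{Q}$ and, for $\theta$ with $f(\theta)=0$ and $K=\mathbb{Q}(\theta)$, the set $\{1,\theta,\theta^2,\theta^3\}$ is a $\mathbb{Z}$-basis of the ring of integers $\mathbb{Z}_K$ of $K$ (equivalently, $\mathbb{Z}_K=\mathbb{Z}[\theta]$). $\mathrm{Gal}(f)$ is the Galois group of $f$ over $\mathbb{Q}$, i.e. the Galois group over $\mathbb{Q}$ of the splitting field of $f$. $C_n$ denotes the cyclic group of order $n$. *)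

theory Defs
  imports Complex_Main "HOL-Algebra.Bij" "HOL-Algebra.Generated_Fields" "HOL-Algebra.Elementary_Groups"
    "HOL-Algebra.Algebraic_Closure_Type"
begin

text \<open>All number fields are realised as subfields of the complex numbers.\<close>

abbreviation complex_ring :: "complex ring"
  where "complex_ring \<equiv> ring_of_type_algebra"

text \<open>A subfield of the complex numbers contains the rationals, so the subfield generated
  by a set is the extension of the rationals obtained by adjoining that set.\<close>

definition adjoin_rat :: "complex set \<Rightarrow> complex set"
  where "adjoin_rat S = generate_field complex_ring S"

lemma field_complex_ring: "field complex_ring" by (rule field_from_type_algebra)

lemma complex_ring_simps: "carrier complex_ring = UNIV" "x \<otimes>\<^bsub>complex_ring\<^esub> y = x * y" "x \<oplus>\<^bsub>complex_ring\<^esub> y = x + y"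
  "\<one>\<^bsub>complex_ring\<^esub> = 1" "\<zero>\<^bsub>complex_ring\<^esub> = 0"
  by (simp_all add: ring_of_type_algebra_def)

lemma subfield_adjoin_rat: "subfield (adjoin_rat S) complex_ring"
  unfolding adjoin_rat_def
  by (rule field.generate_field_is_subfield[OF field_complex_ring]) (simp add: complex_ring_simps)

lemma inv_complex_ring: assumes "x \<noteq> 0" shows "inv\<^bsub>complex_ring\<^esub> x = inverse x"
proof -
  interpret field complex_ring by (rule field_complex_ring)
  show ?thesis using assms by (intro comm_inv_char) (auto simp: complex_ring_simps)
qed

lemma a_inv_complex_ring: "\<ominus>\<^bsub>complex_ring\<^esub> x = - x"
proof -
  interpret field complex_ring by (rule field_complex_ring)
  show ?thesis by (intro minus_equality) (auto simp: complex_ring_simps)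
qed

lemma of_nat_in_adjoin_rat: "of_nat n \<in> adjoin_rat S"
proof (induction n)
  case 0
  interpret field complex_ring by (rule field_complex_ring)
  show ?case using zero_in_generate[of S] by (simp add: adjoin_rat_def complex_ring_simps)
next
  case (Suc n)
  then show ?case
    using generate_field.eng_add[OF generate_field.one[of complex_ring S], of "of_nat n"]
    by (simp add: adjoin_rat_def complex_ring_simps)
qed

lemma of_int_in_adjoin_rat: "of_int n \<in> adjoin_rat S"
  using of_nat_in_adjoin_rat[of "nat n" S] of_nat_in_adjoin_rat[of "nat (-n)" S] 
   generate_field.a_inv[of _ complex_ring S] unfolding adjoin_rat_def a_inv_complex_ring
  by (cases "n \<ge> 0") (simp, metis add.inverse_inverse linorder_not_le neg_0_le_iff_le int_nat_eq less_imp_le of_int_minus of_int_of_nat_eq)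

lemma Rats_subset_adjoin_rat: "\<rat> \<subseteq> adjoin_rat S"
proof
  fix x :: complex assume "x \<in> \<rat>"
  then obtain a b where ab: "b > 0" "x = of_int a / of_int b" by (auto elim: Rats_cases')
  have "inverse (of_int b) \<in> adjoin_rat S" using of_int_in_adjoin_rat[of b S] ab 
    generate_field.m_inv[of "of_int b" complex_ring S] by (simp add: adjoin_rat_def complex_ring_simps inv_complex_ring)
  then show "x \<in> adjoin_rat S" using of_int_in_adjoin_rat[of a S] 
    generate_field.eng_mult[of "of_int a" complex_ring S "inverse (of_int b)"] ab
    by (simp add: adjoin_rat_def complex_ring_simps divide_inverse)
qed

definition ring_of_integers :: "complex set \<Rightarrow> complex set"
  where "ring_of_integers K = {x \<in> K. algebraic_int x}"

definition int_basis :: "nat \<Rightarrow> (nat \<Rightarrow> complex) \<Rightarrow> complex set \<Rightarrow> bool"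
  where "int_basis n b M \<longleftrightarrow>
    M = {x. \<exists>c :: nat \<Rightarrow> int. x = (\<Sum>i<n. of_int (c i) * b i)} \<and>
    (\<forall>c :: nat \<Rightarrow> int. (\<Sum>i<n. of_int (c i) * b i) = 0 \<longrightarrow> (\<forall>i<n. c i = 0))"

definition complex_roots :: "int poly \<Rightarrow> complex set"
  where "complex_roots f = {z. poly (map_poly of_int f) z = 0}"

text \<open>The choice of the root \<open>\<theta>\<close> is immaterial: for irreducible \<open>f\<close> any two roots
  generate isomorphic fields, by an isomorphism that maps one root to the other.\<close>

definition monogenic :: "int poly \<Rightarrow> bool"
  where "monogenic f \<longleftrightarrow>
    lead_coeff f = 1 \<and>
    Factorial_Ring.irreducible (map_poly of_int f :: rat poly) \<and>
    (\<exists>\<theta> \<in> complex_roots f.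
       int_basis (Polynomial.degree f) (\<lambda>i. \<theta> ^ i) (ring_of_integers (adjoin_rat {\<theta>})))"

definition splitting_field :: "int poly \<Rightarrow> complex set"
  where "splitting_field f = adjoin_rat (complex_roots f)"

text \<open>As in \<^const>\<open>AutoGroup\<close>, automorphisms are represented by extensional functions
  and multiplied by composition.\<close>

definition Gal :: "int poly \<Rightarrow> (complex \<Rightarrow> complex) monoid"
  where "Gal f =
    (let L = splitting_field f; R = complex_ring\<lparr>carrier := L\<rparr> in
      BijGroup L \<lparr>carrier := {\<sigma> \<in> Bij L. \<sigma> \<in> ring_hom R R \<and> (\<forall>x\<in>\<rat>. \<sigma> x = x)}\<rparr>)"

lemma group_Gal: "group (Gal f)"
proof -
  define L where "L = splitting_field f"
  define R where "R = complex_ring\<lparr>carrier := L\<rparr>"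
  define A where "A = {\<sigma> \<in> Bij L. \<sigma> \<in> ring_hom R R \<and> (\<forall>x\<in>\<rat>. \<sigma> x = x)}"
  have ra: "\<rat> \<subseteq> L" using Rats_subset_adjoin_rat by (simp add: L_def splitting_field_def)
  have cl: "x \<in> L \<Longrightarrow> y \<in> L \<Longrightarrow> x + y \<in> L" "x \<in> L \<Longrightarrow> y \<in> L \<Longrightarrow> x * y \<in> L" "1 \<in> L" for x y
    using generate_field.eng_add[of x complex_ring _ y] generate_field.eng_mult[of x complex_ring _ y]
      generate_field.one[of complex_ring]
    by (auto simp: complex_ring_simps L_def splitting_field_def adjoin_rat_def)
  have hom: "\<sigma> \<in> ring_hom R R \<longleftrightarrow> \<sigma> \<in> L \<rightarrow> L \<and> \<sigma> 1 = 1 \<and> (\<forall>x\<in>L. \<forall>y\<in>L. \<sigma> (x+y) = \<sigma> x + \<sigma> y \<and> \<sigma> (x*y) = \<sigma> x * \<sigma> y)" for \<sigma>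
    by (auto simp: ring_hom_def R_def complex_ring_simps)
  interpret B: group "BijGroup L" by (rule group_BijGroup)
  have "subgroup A (BijGroup L)"
  proof (rule B.subgroupI)
    show "A \<subseteq> carrier (BijGroup L)" by (auto simp: A_def BijGroup_def)
    have "(\<lambda>x\<in>L. x) \<in> A" using ra cl by (auto simp: A_def hom id_Bij)
    then show "A \<noteq> {}" by blast
  next
    fix s assume s: "s \<in> A"
    then have sb: "s \<in> Bij L" by (simp add: A_def)
    let ?t = "\<lambda>x\<in>L. inv_into L s x"
    have tB: "?t \<in> Bij L" by (rule restrict_inv_into_Bij[OF sb])
    have st: "inv_into L s x = y" if "y \<in> L" "s y = x" for x y
      using sb that by (auto simp: Bij_def bij_betw_def)
    have fixq: "\<forall>x\<in>\<rat>. ?t x = x" using ra s st by (auto simp: A_def)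
    have sh: "\<And>x y. x \<in> L \<Longrightarrow> y \<in> L \<Longrightarrow> s (x + y) = s x + s y" "\<And>x y. x \<in> L \<Longrightarrow> y \<in> L \<Longrightarrow> s (x * y) = s x * s y" "s 1 = 1"
      using s by (auto simp: A_def hom)
    have "?t (x + y) = ?t x + ?t y" "?t (x * y) = ?t x * ?t y" if "x \<in> L" "y \<in> L" for x y
      using Bij_inv_into_lemma[of L s "(+)" x y] Bij_inv_into_lemma[of L s "(*)" x y] sh sb cl that
      by auto
    then have "?t \<in> A" using tB fixq st[of 1 1] sh cl
      by (simp add: A_def hom Bij_imp_funcset)
    then show "inv\<^bsub>BijGroup L\<^esub> s \<in> A" by (simp add: inv_BijGroup sb)
  next
    fix s t assume st: "s \<in> A" "t \<in> A"
    have fs: "s \<in> L \<rightarrow> L" "t \<in> L \<rightarrow> L" using st by (auto simp: A_def Bij_imp_funcset)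
    have "compose L s t \<in> A" using st ra cl fs
      by (auto simp: A_def hom compose_Bij compose_eq Pi_iff)
    then show "s \<otimes>\<^bsub>BijGroup L\<^esub> t \<in> A" using st by (simp add: BijGroup_def A_def)
  qed
  from B.subgroup_imp_group[OF this] show ?thesis
    by (simp add: Gal_def Let_def A_def R_def L_def)
qed
end

theory Submission
  imports Defs "HOL-Computational_Algebra.Computational_Algebra"
begin

text \<open>
  Monogenicity forces \<open>d\<close> to be squarefree: if \<open>p\<^sup>2\<close> divides \<open>d\<close>, then
  \<open>(\<theta>\<^sup>3 + a \<theta>\<^sup>2) / p\<close> is integral. If the Galois group is abelian of order 4, it acts regularly
  on the roots; let \<open>s = (x1 x2)(x3 x4)\<close> be an involution. Then \<open>r = x1 x2 + x3 x4\<close> is an integer with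
  \<open>r\<^sup>3 = d (4 r + a\<^sup>2)\<close>, so \<open>d\<close> divides \<open>r\<close>. The element \<open>w = (x1 - x2)(x3 - x4)\<close> satisfies
  \<open>w\<^sup>2 = 16 d - 3 r\<^sup>2\<close>, and the group fixes \<open>w\<close> (noncyclic case) or \<open>w (x1 x2 - x3 x4)\<close> (cyclic case).
  Hence \<open>16 d - 3 r\<^sup>2\<close> is a nonzero square, or \<open>(16 d - 3 r\<^sup>2) (r\<^sup>2 - 4 d) > 0\<close>. With \<open>r = d e\<close> this
  leaves only the possibilities \<open>0 < d e\<^sup>2 \<le> 5\<close>, and none of them solves the equation for \<open>a\<close>.
\<close>

section \<open>Subfields of the complex numbers and their embeddings\<close>

text \<open>Closure under \<open>inverse\<close> can be asked at every element, 0 included, because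
  \<open>inverse 0 = 0\<close>. Membership of 0 comes from 1 and -1.\<close>

lemma subfield_complexI:
  assumes "1 \<in> F" and "\<And>x. x \<in> F \<Longrightarrow> - x \<in> F" and "\<And>x. x \<in> F \<Longrightarrow> inverse x \<in> F"
    and "\<And>x y. x \<in> F \<Longrightarrow> y \<in> F \<Longrightarrow> x + y \<in> F" and "\<And>x y. x \<in> F \<Longrightarrow> y \<in> F \<Longrightarrow> x * y \<in> F"
  shows "subfield F complex_ring"
proof -
  interpret C: field complex_ring by (rule field_complex_ring)
  show ?thesis
  proof (rule C.subfieldI')
    show "subring F complex_ring"
      by (rule C.subringI) (use assms in \<open>auto simp: complex_ring_simps a_inv_complex_ring\<close>)
    show "inv\<^bsub>complex_ring\<^esub> k \<in> F" if "k \<in> F - {\<zero>\<^bsub>complex_ring\<^esub>}" for k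
      using that assms by (auto simp: complex_ring_simps inv_complex_ring)
  qed
qed

lemma subfield_complex_closed:
  assumes "subfield F complex_ring"
  shows "0 \<in> F" and "1 \<in> F" and "x \<in> F \<Longrightarrow> - x \<in> F" and "x \<in> F \<Longrightarrow> inverse x \<in> F"
    and "x \<in> F \<Longrightarrow> y \<in> F \<Longrightarrow> x + y \<in> F" and "x \<in> F \<Longrightarrow> y \<in> F \<Longrightarrow> x * y \<in> F"
    and "x \<in> F \<Longrightarrow> y \<in> F \<Longrightarrow> x - y \<in> F"
proof -
  interpret C: field complex_ring by (rule field_complex_ring)
  interpret S: subfield F complex_ring by (rule assms)
  have sub: "subring F complex_ring" by unfold_locales
  note E = subringE[OF sub, unfolded complex_ring_simps a_inv_complex_ring]
  show "0 \<in> F" "1 \<in> F" and m: "x \<in> F \<Longrightarrow> - x \<in> F" for x using E by auto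
  show add: "x \<in> F \<Longrightarrow> y \<in> F \<Longrightarrow> x + y \<in> F" and "x \<in> F \<Longrightarrow> y \<in> F \<Longrightarrow> x * y \<in> F" for x y
    using E(6,7) by auto
  show "x \<in> F \<Longrightarrow> y \<in> F \<Longrightarrow> x - y \<in> F" using add[of x "- y"] m[of y] by simp
  show "inverse x \<in> F" if "x \<in> F"
  proof (cases "x = 0")
    case True
    then show ?thesis using E by simp
  next
    case False
    then show ?thesis using C.subfield_m_inv(1)[OF assms, of x] that
      by (simp add: complex_ring_simps inv_complex_ring)
  qed
qed

lemma subfield_complex_sum:
  assumes "subfield F complex_ring" and "\<And>i. i \<in> A \<Longrightarrow> g i \<in> F"
  shows "sum g A \<in> F"
  using assms(2) by (induction A rule: infinite_finite_induct) (auto intro: subfield_complex_closed[OF assms(1)])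

lemma subset_adjoin_rat: "S \<subseteq> adjoin_rat S"
  by (auto simp: adjoin_rat_def intro: generate_field.incl)

lemma adjoin_rat_minimal:
  assumes "subfield F complex_ring" and "S \<subseteq> F"
  shows "adjoin_rat S \<subseteq> F"
proof -
  interpret C: field complex_ring by (rule field_complex_ring)
  show ?thesis unfolding adjoin_rat_def
    by (rule C.generate_field_min_subfield1) (use assms in \<open>auto simp: complex_ring_simps\<close>)
qed

lemma Rats_subset_subfield: "subfield F complex_ring \<Longrightarrow> \<rat> \<subseteq> F"
  using Rats_subset_adjoin_rat[of "{}"] adjoin_rat_minimal[of F "{}"] by blast

lemma subfield_Rats: "subfield \<rat> complex_ring"
  by (rule subfield_complexI) auto

section \<open>Polynomials over a subfield, minimal polynomials and simple extensions\<close>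

lemma degree_pos_of_root:
  fixes h :: "complex poly"
  assumes "h \<noteq> 0" "poly h x = 0"
  shows "Polynomial.degree h > 0"
proof (rule ccontr)
  assume "\<not> Polynomial.degree h > 0"
  then obtain c where "h = [:c:]" using degree_eq_zeroE by blast
  then show False using assms by simp
qed

text \<open>The polynomials stay in the type \<open>complex poly\<close>, so evaluation, degree and
  divisibility need no separate version for each subfield.\<close>

definition polys_over :: "complex set \<Rightarrow> complex poly set" where
  "polys_over F = {p. \<forall>i. poly.coeff p i \<in> F}"

lemma polys_over_mono: "F \<subseteq> E \<Longrightarrow> polys_over F \<subseteq> polys_over E"
  by (auto simp: polys_over_def)

context
  fixes F :: "complex set"
  assumes F: "subfield F complex_ring"
begin

lemma polys_over_add: "p \<in> polys_over F \<Longrightarrow> q \<in> polys_over F \<Longrightarrow> p + q \<in> polys_over F"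
  and polys_over_diff: "p \<in> polys_over F \<Longrightarrow> q \<in> polys_over F \<Longrightarrow> p - q \<in> polys_over F"
  and polys_over_uminus: "p \<in> polys_over F \<Longrightarrow> - p \<in> polys_over F"
  and polys_over_mult: "p \<in> polys_over F \<Longrightarrow> q \<in> polys_over F \<Longrightarrow> p * q \<in> polys_over F"
  and polys_over_monom: "c \<in> F \<Longrightarrow> Polynomial.monom c n \<in> polys_over F"
  and polys_over_0: "0 \<in> polys_over F"
  and polys_over_1: "1 \<in> polys_over F"
  and polys_over_pCons: "c \<in> F \<Longrightarrow> p \<in> polys_over F \<Longrightarrow> pCons c p \<in> polys_over F"
  by (auto simp: polys_over_def coeff_mult coeff_pCons split: nat.splits
      intro!: subfield_complex_closed[OF F] subfield_complex_sum[OF F])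

lemma polys_over_pderiv: "p \<in> polys_over F \<Longrightarrow> pderiv p \<in> polys_over F"
proof -
  have "of_nat n \<in> F" for n using Rats_subset_subfield[OF F] by auto
  then show "p \<in> polys_over F \<Longrightarrow> pderiv p \<in> polys_over F"
    by (auto simp: polys_over_def coeff_pderiv simp del: of_nat_Suc
        intro!: subfield_complex_closed[OF F])
qed

text \<open>Long division: subtracting the multiple of \<open>q\<close> that cancels the leading
  term lowers the degree. Its coefficient is a quotient of elements of \<open>F\<close>, so
  everything stays over \<open>F\<close>.\<close>

lemma polys_over_division:
  assumes "p \<in> polys_over F" "q \<in> polys_over F" "q \<noteq> 0"
  shows "\<exists>s r. s \<in> polys_over F \<and> r \<in> polys_over F \<and> p = q * s + r \<and>
    (r = 0 \<or> Polynomial.degree r < Polynomial.degree q)"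
  using assms(1)
proof (induction "Polynomial.degree p" arbitrary: p rule: less_induct)
  case less
  show ?case
  proof (cases "p = 0 \<or> Polynomial.degree p < Polynomial.degree q")
    case True
    then show ?thesis using less.prems polys_over_0 by (intro exI[of _ 0] exI[of _ p]) auto
  next
    case False
    define c where "c = lead_coeff p * inverse (lead_coeff q)"
    define m where "m = Polynomial.monom c (Polynomial.degree p - Polynomial.degree q)"
    define p' where "p' = p - q * m"
    have cF: "c \<in> F" using less.prems assms
      by (auto simp: c_def polys_over_def intro!: subfield_complex_closed[OF F])
    have c0: "c \<noteq> 0" using False assms by (auto simp: c_def)
    have mF: "m \<in> polys_over F" unfolding m_def by (rule polys_over_monom[OF cF])
    have m0: "m \<noteq> 0" using c0 by (simp add: m_def)
    have p'F: "p' \<in> polys_over F" unfolding p'_def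
      using less.prems assms mF by (intro polys_over_diff polys_over_mult)
    have deg: "Polynomial.degree (q * m) = Polynomial.degree p" using False assms m0 c0
      by (simp add: degree_mult_eq) (simp add: m_def degree_monom_eq[OF c0])
    have lc: "lead_coeff (q * m) = lead_coeff p" 
    proof -
      have "lead_coeff m = c" using c0 by (simp add: m_def degree_monom_eq)
      then show ?thesis using assms by (simp add: lead_coeff_mult c_def)
    qed
    have p'lt: "p' = 0 \<or> Polynomial.degree p' < Polynomial.degree p"
    proof -
      have le: "Polynomial.degree p' \<le> Polynomial.degree p" unfolding p'_def
        by (rule degree_diff_le) (simp_all add: deg)
      have c: "poly.coeff p' (Polynomial.degree p) = 0" using lc deg by (simp add: p'_def)
      show ?thesis using le c by (metis eq_zero_or_degree_less)
    qed
    show ?thesis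
    proof (cases "p' = 0")
      case True
      then have "p = q * m + 0" by (simp add: p'_def)
      then show ?thesis using mF polys_over_0 by blast
    next
      case False
      then obtain s r where sr: "s \<in> polys_over F" "r \<in> polys_over F" "p' = q * s + r"
        "r = 0 \<or> Polynomial.degree r < Polynomial.degree q"
        using less.hyps[OF _ p'F] p'lt by blast
      have "p = q * (s + m) + r" using sr(3) by (simp add: p'_def algebra_simps)
      then show ?thesis using sr mF polys_over_add by blast
    qed
  qed
qed

text \<open>A nonzero annihilator of least degree serves as minimal polynomial; it is not normalised
  to be monic.\<close>

lemma minimal_poly_exists:
  assumes "p \<in> polys_over F" "p \<noteq> 0" "poly p x = 0"
  obtains h where "h \<in> polys_over F" "h \<noteq> 0" "poly h x = 0" 
    "\<And>q. q \<in> polys_over F \<Longrightarrow> q \<noteq> 0 \<Longrightarrow> poly q x = 0 \<Longrightarrow> Polynomial.degree h \<le> Polynomial.degree q"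
proof -
  let ?P = "\<lambda>q. q \<in> polys_over F \<and> q \<noteq> 0 \<and> poly q x = 0"
  have "?P p" using assms by simp
  then have "?P (arg_min Polynomial.degree ?P) \<and>
    (\<forall>q. ?P q \<longrightarrow> Polynomial.degree (arg_min Polynomial.degree ?P) \<le> Polynomial.degree q)"
    by (rule arg_min_nat_lemma)
  then show ?thesis using that by blast
qed

text \<open>The remainder of \<open>q\<close> modulo \<open>h\<close> vanishes at \<open>x\<close>
  and has smaller degree than \<open>h\<close>, so minimality makes it zero.\<close>

lemma minimal_poly_factor:
  assumes h: "h \<in> polys_over F" "h \<noteq> 0" "poly h x = 0"
    and min: "\<And>q. q \<in> polys_over F \<Longrightarrow> q \<noteq> 0 \<Longrightarrow> poly q x = 0 \<Longrightarrow> Polynomial.degree h \<le> Polynomial.degree q"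
    and q: "q \<in> polys_over F" "poly q x = 0"
  obtains s where "s \<in> polys_over F" "q = h * s"
proof -
  obtain s r where sr: "s \<in> polys_over F" "r \<in> polys_over F" "q = h * s + r"
    "r = 0 \<or> Polynomial.degree r < Polynomial.degree h"
    using polys_over_division[OF q(1) h(1,2)] by blast
  have "poly r x = 0" using sr(3) q h by simp
  then have "r = 0" using min[OF sr(2)] sr(4) by linarith
  then show ?thesis using that sr by simp
qed

text \<open>After reduction of \<open>q\<close> modulo the minimal polynomial \<open>h\<close>, a
  Euclidean descent applies: from \<open>h = r * s + t\<close> the value of \<open>r * s\<close> at
  \<open>x\<close> is minus that of \<open>t\<close>, so an inverse \<open>g\<close> for the
  remainder \<open>t\<close> yields the inverse \<open>- g * s\<close> for \<open>r\<close>.\<close>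

lemma inverse_in_simple_extension:
  assumes alg: "p \<in> polys_over F" "p \<noteq> 0" "poly p x = 0"
    and q: "q \<in> polys_over F" "poly q x \<noteq> 0"
  shows "\<exists>g \<in> polys_over F. poly g x * poly q x = 1"
proof -
  obtain h where h: "h \<in> polys_over F" "h \<noteq> 0" "poly h x = 0" and
    min: "\<And>q. q \<in> polys_over F \<Longrightarrow> q \<noteq> 0 \<Longrightarrow> poly q x = 0 \<Longrightarrow> Polynomial.degree h \<le> Polynomial.degree q"
    using minimal_poly_exists[OF alg] by blast
  have main: "\<exists>g \<in> polys_over F. poly g x * poly r x = 1"
    if "r \<in> polys_over F" "poly r x \<noteq> 0" "Polynomial.degree r < Polynomial.degree h" for r
    using that
  proof (induction "Polynomial.degree r" arbitrary: r rule: less_induct)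
    case less
    have r0: "r \<noteq> 0" using less.prems by auto
    show ?case
    proof (cases "Polynomial.degree r = 0")
      case True
      then obtain c where c: "r = [:c:]" by (rule degree_eq_zeroE)
      have "c \<in> F" using less.prems(1) unfolding c polys_over_def by (auto dest: spec[of _ 0])
      then have "[:inverse c:] \<in> polys_over F"
        by (intro polys_over_pCons polys_over_0 subfield_complex_closed[OF F])
      then show ?thesis using c r0 by (intro bexI[of _ "[:inverse c:]"]) auto
    next
      case False
      obtain s t where st: "s \<in> polys_over F" "t \<in> polys_over F" "h = r * s + t"
        "t = 0 \<or> Polynomial.degree t < Polynomial.degree r"
        using polys_over_division[OF h(1) less.prems(1) r0] by blast
      have eq: "poly r x * poly s x + poly t x = 0" using h(3) st(3) by simp
      \<comment> \<open>If \<open>t = 0\<close>, then \<open>s\<close> annihilates \<open>x\<close>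
        and has smaller degree than \<open>h\<close>, since \<open>r\<close> is not
        constant.\<close>
      have t0: "t \<noteq> 0"
      proof
        assume "t = 0"
        then have hs: "h = r * s" and s0: "poly s x = 0" using st eq less.prems by auto
        then have "s \<noteq> 0" using h by auto
        moreover have "Polynomial.degree s < Polynomial.degree h"
          using hs r0 \<open>s \<noteq> 0\<close> False by (simp add: degree_mult_eq)
        ultimately show False using min[of s] st s0 by auto
      qed
      then have tl: "Polynomial.degree t < Polynomial.degree r" using st by auto
      then have "poly t x \<noteq> 0" using min[of t] t0 st less.prems by auto
      then obtain g where g: "g \<in> polys_over F" "poly g x * poly t x = 1"
        using less.hyps[OF tl st(2)] tl less.prems by auto
      have "poly (- g * s) x * poly r x = - poly g x * (poly r x * poly s x)" by simp
      also have "poly r x * poly s x = - poly t x" using eq by (simp add: eq_neg_iff_add_eq_0)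
      also have "- poly g x * (- poly t x) = 1" using g by simp
      finally have "poly (- g * s) x * poly r x = 1" .
      then show ?thesis using g st polys_over_mult polys_over_uminus by blast
    qed
  qed
  obtain s r where sr: "s \<in> polys_over F" "r \<in> polys_over F" "q = h * s + r"
    "r = 0 \<or> Polynomial.degree r < Polynomial.degree h"
    using polys_over_division[OF q(1) h(1,2)] by blast
  have "poly r x = poly q x" using sr(3) h by simp
  then show ?thesis using main[of r] sr q by auto
qed

text \<open>The ring \<open>F[x]\<close> is already the field \<open>F(x)\<close> when
  \<open>x\<close> is algebraic; only closure under inverses uses algebraicity.\<close>

lemma subfield_simple_extension:
  assumes alg: "p \<in> polys_over F" "p \<noteq> 0" "poly p x = 0"
  shows "subfield ((\<lambda>q. poly q x) ` polys_over F) complex_ring"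
proof (rule subfield_complexI)
  let ?E = "(\<lambda>q. poly q x) ` polys_over F"
  have I: "y \<in> ?E" if "q \<in> polys_over F" "poly q x = y" for q y using that by blast
  show "1 \<in> ?E" using I[OF polys_over_1] by simp
  show "- y \<in> ?E" if "y \<in> ?E" for y using that by (auto intro: I[OF polys_over_uminus])
  show "y + z \<in> ?E" if "y \<in> ?E" "z \<in> ?E" for y z using that by (auto intro: I[OF polys_over_add])
  show "y * z \<in> ?E" if "y \<in> ?E" "z \<in> ?E" for y z using that by (auto intro: I[OF polys_over_mult])
  show "inverse y \<in> ?E" if y: "y \<in> ?E" for y
  proof (cases "y = 0")
    case True then show ?thesis using I[OF polys_over_0] by simp
  next
    case False
    from y obtain q where q: "q \<in> polys_over F" "y = poly q x" by blast
    then obtain g where "g \<in> polys_over F" "poly g x * y = 1"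
      using inverse_in_simple_extension[OF alg, of q] False by auto
    moreover from this have "poly g x = inverse y" using False by (simp add: field_simps)
    ultimately show ?thesis by (blast intro: I)
  qed
qed

end

section \<open>Field embeddings and their extension\<close>

text \<open>Values outside \<open>F\<close> are unconstrained, so one total function can be
  restricted to smaller fields without change. For a subfield \<open>F\<close>,
  \<open>emb_inj_on\<close> and \<open>emb_Rats\<close> derive injectivity and that rationals are
  fixed.\<close>

definition field_emb :: "complex set \<Rightarrow> (complex \<Rightarrow> complex) \<Rightarrow> bool" where
  "field_emb F \<sigma> \<longleftrightarrow> \<sigma> 1 = 1 \<and> (\<forall>x\<in>F. \<forall>y\<in>F. \<sigma> (x + y) = \<sigma> x + \<sigma> y \<and> \<sigma> (x * y) = \<sigma> x * \<sigma> y)"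

context
  fixes F :: "complex set" and \<sigma> :: "complex \<Rightarrow> complex"
  assumes F: "subfield F complex_ring" and emb: "field_emb F \<sigma>"
begin

lemma emb_simps:
  "\<sigma> 1 = 1" "\<sigma> 0 = 0" "x \<in> F \<Longrightarrow> y \<in> F \<Longrightarrow> \<sigma> (x + y) = \<sigma> x + \<sigma> y" 
  "x \<in> F \<Longrightarrow> y \<in> F \<Longrightarrow> \<sigma> (x * y) = \<sigma> x * \<sigma> y" "x \<in> F \<Longrightarrow> \<sigma> (- x) = - \<sigma> x"
  "x \<in> F \<Longrightarrow> y \<in> F \<Longrightarrow> \<sigma> (x - y) = \<sigma> x - \<sigma> y" "x \<in> F \<Longrightarrow> \<sigma> (inverse x) = inverse (\<sigma> x)"
proof -
  note cl = subfield_complex_closed[OF F]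
  show "\<sigma> 1 = 1" using emb by (simp add: field_emb_def)
  show add: "\<sigma> (x + y) = \<sigma> x + \<sigma> y" and mult: "\<sigma> (x * y) = \<sigma> x * \<sigma> y" if "x \<in> F" "y \<in> F" for x y
    using emb that by (auto simp: field_emb_def)
  show zero: "\<sigma> 0 = 0" using add[of 0 0] cl by simp
  show m: "\<sigma> (- x) = - \<sigma> x" if "x \<in> F" for x
    using add[of "- x" x] that cl zero by (simp add: eq_neg_iff_add_eq_0)
  show "\<sigma> (x - y) = \<sigma> x - \<sigma> y" if "x \<in> F" "y \<in> F" for x y
    using add[of x "- y"] m[of y] that cl by simp
  show "\<sigma> (inverse x) = inverse (\<sigma> x)" if "x \<in> F" for x
  proof (cases "x = 0")
    case False
    then have "\<sigma> x * \<sigma> (inverse x) = 1" using mult[of x "inverse x"] that cl \<open>\<sigma> 1 = 1\<close> by simp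
    then show ?thesis by (metis inverse_unique)
  qed (simp add: zero)
qed

lemma emb_eq_0_iff: "x \<in> F \<Longrightarrow> \<sigma> x = 0 \<longleftrightarrow> x = 0"
  using emb_simps(1,2) emb_simps(4)[of x "inverse x"] subfield_complex_closed(4)[OF F, of x]
  by (cases "x = 0") auto

lemma emb_inj_on: "inj_on \<sigma> F"
proof (rule inj_onI)
  fix x y assume "x \<in> F" "y \<in> F" "\<sigma> x = \<sigma> y"
  then show "x = y" using emb_eq_0_iff[of "x - y"] emb_simps(6)[of x y] subfield_complex_closed[OF F] by simp
qed

lemma emb_sum: "(\<And>i. i \<in> A \<Longrightarrow> g i \<in> F) \<Longrightarrow> \<sigma> (sum g A) = (\<Sum>i\<in>A. \<sigma> (g i))"
  by (induction A rule: infinite_finite_induct) 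
    (auto simp: emb_simps subfield_complex_sum[OF F])

lemma emb_Rats: assumes "x \<in> \<rat>" shows "\<sigma> x = x"
proof -
  have R: "\<rat> \<subseteq> F" by (rule Rats_subset_subfield[OF F])
  have n: "\<sigma> (of_nat n) = of_nat n" for n
    using R by (induction n) (auto simp: emb_simps subset_iff)
  have i: "\<sigma> (of_int k) = of_int k" for k
    using R n by (cases k) (auto simp: emb_simps subset_iff simp del: of_nat_Suc)
  from assms obtain a b where "b > 0" "x = of_int a / of_int b" by (auto elim: Rats_cases')
  then show ?thesis using R i by (simp add: divide_inverse emb_simps subset_iff)
qed

lemma coeff_map_poly_emb: "poly.coeff (map_poly \<sigma> p) i = \<sigma> (poly.coeff p i)"
  by (simp add: coeff_map_poly emb_simps)

lemma polys_overD: "p \<in> polys_over F \<Longrightarrow> poly.coeff p i \<in> F"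
  by (simp add: polys_over_def)

lemma map_poly_emb_add: "p \<in> polys_over F \<Longrightarrow> q \<in> polys_over F \<Longrightarrow> map_poly \<sigma> (p + q) = map_poly \<sigma> p + map_poly \<sigma> q"
  and map_poly_emb_diff: "p \<in> polys_over F \<Longrightarrow> q \<in> polys_over F \<Longrightarrow> map_poly \<sigma> (p - q) = map_poly \<sigma> p - map_poly \<sigma> q"
  by (auto intro!: poly_eqI simp: coeff_map_poly_emb emb_simps polys_overD)

lemma map_poly_emb_mult: "p \<in> polys_over F \<Longrightarrow> q \<in> polys_over F \<Longrightarrow> map_poly \<sigma> (p * q) = map_poly \<sigma> p * map_poly \<sigma> q"
  by (auto intro!: poly_eqI sum.cong simp: coeff_map_poly_emb coeff_mult emb_simps polys_overD emb_sum
    subfield_complex_closed[OF F])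

lemma degree_map_poly_emb: "p \<in> polys_over F \<Longrightarrow> Polynomial.degree (map_poly \<sigma> p) = Polynomial.degree p"
  by (cases "p = 0") (auto intro!: map_poly_degree_eq simp: emb_eq_0_iff polys_overD)

lemma poly_map_poly_emb:
  assumes "p \<in> polys_over F" "x \<in> F"
  shows "\<sigma> (poly p x) = poly (map_poly \<sigma> p) (\<sigma> x)"
proof -
  have pw: "x ^ i \<in> F" "\<sigma> (x ^ i) = \<sigma> x ^ i" for i
    using assms by (induction i) (auto simp: emb_simps subfield_complex_closed[OF F])
  show ?thesis using assms
    by (simp add: poly_altdef degree_map_poly_emb coeff_map_poly_emb emb_sum polys_overD 
      subfield_complex_closed[OF F] emb_simps pw)
qed

text \<open>The extension sends the value of \<open>q\<close> at \<open>x\<close> to the value at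
  \<open>y\<close> of \<open>q\<close> with \<sigma> applied to its coefficients. The assumption
  \<open>compat\<close> says exactly that this is independent of the choice of
  \<open>q\<close>.\<close>

lemma extend_emb_simple:
  assumes alg: "p \<in> polys_over F" "p \<noteq> 0" "poly p x = 0"
    and compat: "\<And>q. q \<in> polys_over F \<Longrightarrow> poly q x = 0 \<Longrightarrow> poly (map_poly \<sigma> q) y = 0"
  shows "\<exists>E \<tau>. subfield E complex_ring \<and> F \<subseteq> E \<and> x \<in> E \<and> field_emb E \<tau> \<and> (\<forall>z\<in>F. \<tau> z = \<sigma> z) \<and> \<tau> x = y"
proof -
  define E where "E = (\<lambda>q. poly q x) ` polys_over F"
  define \<tau> where "\<tau> z = poly (map_poly \<sigma> (SOME q. q \<in> polys_over F \<and> poly q x = z)) y" for z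
  have E: "subfield E complex_ring" unfolding E_def by (rule subfield_simple_extension[OF F alg])
  have \<tau>: "\<tau> (poly q x) = poly (map_poly \<sigma> q) y" if q: "q \<in> polys_over F" for q
  proof -
    define q' where "q' = (SOME q'. q' \<in> polys_over F \<and> poly q' x = poly q x)"
    have q': "q' \<in> polys_over F" "poly q' x = poly q x"
      using someI[of "\<lambda>q'. q' \<in> polys_over F \<and> poly q' x = poly q x" q] q by (auto simp: q'_def)
    then have "poly (map_poly \<sigma> (q' - q)) y = 0"
      using q by (intro compat polys_over_diff[OF F]) auto
    then have "poly (map_poly \<sigma> q') y = poly (map_poly \<sigma> q) y"
      using q q' by (simp add: map_poly_emb_diff)
    then show ?thesis by (simp add: \<tau>_def q'_def)
  qed
  note cl = subfield_complex_closed[OF F]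
  have const: "[:c:] \<in> polys_over F" if "c \<in> F" for c
    using that by (intro polys_over_pCons[OF F] polys_over_0[OF F])
  have X: "[:0, 1:] \<in> polys_over F" by (intro polys_over_pCons[OF F] polys_over_0[OF F] cl)
  have \<tau>F: "\<tau> c = \<sigma> c" if "c \<in> F" for c
    using \<tau>[OF const[OF that]] by (simp add: map_poly_pCons emb_simps)
  have \<tau>x: "\<tau> x = y" using \<tau>[OF X] by (simp add: map_poly_pCons emb_simps)
  have FE: "F \<subseteq> E" unfolding E_def
  proof
    fix c assume "c \<in> F"
    then show "c \<in> (\<lambda>q. poly q x) ` polys_over F" by (intro image_eqI[OF _ const]) auto
  qed
  have xE: "x \<in> E" unfolding E_def by (intro image_eqI[OF _ X]) auto
  have "field_emb E \<tau>" unfolding field_emb_def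
  proof (intro conjI ballI)
    show "\<tau> 1 = 1" using \<tau>F cl emb_simps by simp
  next
    fix u v assume "u \<in> E" "v \<in> E"
    then obtain p q where pq: "p \<in> polys_over F" "q \<in> polys_over F" and uv: "u = poly p x" "v = poly q x"
      by (auto simp: E_def)
    show "\<tau> (u + v) = \<tau> u + \<tau> v"
      using \<tau>[OF polys_over_add[OF F pq]] \<tau> pq by (simp add: uv map_poly_emb_add)
    show "\<tau> (u * v) = \<tau> u * \<tau> v"
      using \<tau>[OF polys_over_mult[OF F pq]] \<tau> pq by (simp add: uv map_poly_emb_mult)
  qed
  with E FE xE \<tau>F \<tau>x show ?thesis by blast
qed

text \<open>Any root \<open>y\<close> of the image of the minimal polynomial \<open>h\<close> works,
  since every annihilator of \<open>x\<close> is a multiple of \<open>h\<close>. The image keeps the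
  positive degree of \<open>h\<close>, so a complex root exists.\<close>

lemma conjugate_exists:
  assumes alg: "p \<in> polys_over F" "p \<noteq> 0" "poly p x = 0"
  obtains y where "\<And>q. q \<in> polys_over F \<Longrightarrow> poly q x = 0 \<Longrightarrow> poly (map_poly \<sigma> q) y = 0"
proof -
  obtain h where h: "h \<in> polys_over F" "h \<noteq> 0" "poly h x = 0" and
    min: "\<And>q. q \<in> polys_over F \<Longrightarrow> q \<noteq> 0 \<Longrightarrow> poly q x = 0 \<Longrightarrow> Polynomial.degree h \<le> Polynomial.degree q"
    using minimal_poly_exists[OF F alg] by blast
  have "Polynomial.degree (map_poly \<sigma> h) > 0"
    using h degree_pos_of_root degree_map_poly_emb by metis
  then obtain y where y: "poly (map_poly \<sigma> h) y = 0"
    using fundamental_theorem_of_algebra constant_degree by (metis less_numeral_extra(3))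
  have "poly (map_poly \<sigma> q) y = 0" if "q \<in> polys_over F" "poly q x = 0" for q
  proof -
    obtain s where "s \<in> polys_over F" "q = h * s" 
      using minimal_poly_factor[OF F h min \<open>q \<in> polys_over F\<close> \<open>poly q x = 0\<close>] by blast
    then show ?thesis using h y by (simp add: map_poly_emb_mult)
  qed
  then show ?thesis by (rule that)
qed

end

text \<open>The elements of \<open>S\<close> are adjoined one at a time; a rational annihilator is
  also one over the field reached so far.\<close>

lemma extend_emb:
  assumes "finite S" and "subfield F complex_ring" "field_emb F \<sigma>"
    and "\<And>x. x \<in> S \<Longrightarrow> \<exists>p \<in> polys_over \<rat>. p \<noteq> 0 \<and> poly p x = 0"
  shows "\<exists>E \<tau>. subfield E complex_ring \<and> F \<subseteq> E \<and> S \<subseteq> E \<and> field_emb E \<tau> \<and> (\<forall>z\<in>F. \<tau> z = \<sigma> z)"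
  using assms
proof (induction S)
  case empty
  then show ?case by blast
next
  case (insert x S)
  then obtain E \<tau> where E: "subfield E complex_ring" "F \<subseteq> E" "S \<subseteq> E" "field_emb E \<tau>" "\<forall>z\<in>F. \<tau> z = \<sigma> z"
    by blast
  from insert.prems(3)[of x] obtain p where p: "p \<in> polys_over E" "p \<noteq> 0" "poly p x = 0"
    using polys_over_mono[OF Rats_subset_subfield[OF E(1)]] by blast
  obtain y where y: "\<And>q. q \<in> polys_over E \<Longrightarrow> poly q x = 0 \<Longrightarrow> poly (map_poly \<tau> q) y = 0"
    using conjugate_exists[OF E(1,4) p] by blast
  obtain E' \<tau>' where "subfield E' complex_ring" "E \<subseteq> E'" "x \<in> E'" "field_emb E' \<tau>'" "\<forall>z\<in>E. \<tau>' z = \<tau> z"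
    using extend_emb_simple[OF E(1,4) p y] by blast
  then show ?case using E by (intro exI[of _ E'] exI[of _ \<tau>']) auto
qed

section \<open>Galois automorphisms\<close>

text \<open>Brings the Galois group within reach of the embedding lemmas; \<open>emb_Rats\<close>
  accounts for the condition on the rationals.\<close>

lemma carrier_Gal:
  "carrier (Gal f) = {\<sigma> \<in> Bij (splitting_field f). field_emb (splitting_field f) \<sigma>}"
proof -
  define L where "L = splitting_field f"
  have L: "subfield L complex_ring" by (simp add: L_def splitting_field_def subfield_adjoin_rat)
  have "\<sigma> \<in> ring_hom (complex_ring\<lparr>carrier := L\<rparr>) (complex_ring\<lparr>carrier := L\<rparr>) \<and> (\<forall>x\<in>\<rat>. \<sigma> x = x) \<longleftrightarrow>
    field_emb L \<sigma>" if "\<sigma> \<in> Bij L" for \<sigma>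
  proof -
    have "\<sigma> \<in> ring_hom (complex_ring\<lparr>carrier := L\<rparr>) (complex_ring\<lparr>carrier := L\<rparr>) \<longleftrightarrow> field_emb L \<sigma>"
      using Bij_imp_funcset[OF that] by (auto simp: ring_hom_def complex_ring_simps field_emb_def)
    then show ?thesis using emb_Rats[OF L, of \<sigma>] by blast
  qed
  then show ?thesis unfolding Gal_def Let_def L_def[symmetric] by simp blast
qed

lemma mult_Gal:
  assumes "\<sigma> \<in> carrier (Gal f)" "\<tau> \<in> carrier (Gal f)" "x \<in> splitting_field f"
  shows "(\<sigma> \<otimes>\<^bsub>Gal f\<^esub> \<tau>) x = \<sigma> (\<tau> x)"
  using assms by (auto simp: carrier_Gal) (simp add: Gal_def Let_def BijGroup_def compose_eq)

lemma one_Gal: "x \<in> splitting_field f \<Longrightarrow> \<one>\<^bsub>Gal f\<^esub> x = x"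
  by (simp add: Gal_def Let_def BijGroup_def)

lemma of_int_poly_over_Rats: "map_poly of_int f \<in> polys_over \<rat>"
  by (simp add: polys_over_def coeff_map_poly)

lemma poly_Rats_emb:
  assumes "subfield F complex_ring" "field_emb F \<sigma>" "q \<in> polys_over \<rat>" "x \<in> F"
  shows "poly q (\<sigma> x) = \<sigma> (poly q x)"
proof -
  have "map_poly \<sigma> q = q"
    using assms(3) by (intro poly_eqI)
      (simp add: coeff_map_poly_emb[OF assms(1,2)] emb_Rats[OF assms(1,2)] polys_over_def)
  then show ?thesis
    using poly_map_poly_emb[OF assms(1,2) _ assms(4), of q] assms(3)
      polys_over_mono[OF Rats_subset_subfield[OF assms(1)]] by auto
qed

text \<open>The identity of the rationals is extended first by sending \<open>x\<close> to
  \<open>y\<close>, then to a field containing all roots of \<open>f\<close>. It permutes the roots,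
  hence restricts to an automorphism of the splitting field.\<close>

lemma Gal_automorphism_exists:
  assumes "f \<noteq> 0" and x: "x \<in> splitting_field f"
    and p: "p \<in> polys_over \<rat>" "p \<noteq> 0" "poly p x = 0"
    and compat: "\<And>q. q \<in> polys_over \<rat> \<Longrightarrow> poly q x = 0 \<Longrightarrow> poly q y = 0"
  shows "\<exists>\<sigma> \<in> carrier (Gal f). \<sigma> x = y"
proof -
  define F :: "complex poly" where "F = map_poly of_int f"
  define R where "R = complex_roots f"
  define L where "L = splitting_field f"
  have LR: "L = adjoin_rat R" by (simp add: L_def R_def splitting_field_def)
  have L: "subfield L complex_ring" by (simp add: LR subfield_adjoin_rat)
  have F: "F \<in> polys_over \<rat>" by (simp add: F_def of_int_poly_over_Rats)
  have F0: "F \<noteq> 0" using assms(1) unfolding F_def by (subst map_poly_eq_0_iff) auto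
  have R: "R = {z. poly F z = 0}" by (simp add: R_def complex_roots_def F_def)
  have finR: "finite R" unfolding R using F0 by (rule poly_roots_finite)
  have id: "field_emb \<rat> (\<lambda>x. x)" by (simp add: field_emb_def)
  have "poly (map_poly (\<lambda>x. x) q) y = 0" if "q \<in> polys_over \<rat>" "poly q x = 0" for q
    using compat[OF that] by (simp add: map_poly_idI)
  from extend_emb_simple[OF subfield_Rats id p this]
  obtain E1 \<tau>1 where E1: "subfield E1 complex_ring" "field_emb E1 \<tau>1" "x \<in> E1" "\<tau>1 x = y" by blast
  obtain E \<tau> where E: "subfield E complex_ring" "E1 \<subseteq> E" "R \<subseteq> E" "field_emb E \<tau>" "\<forall>z\<in>E1. \<tau> z = \<tau>1 z"
    using extend_emb[OF finR E1(1,2)] F F0 R by blast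
  have LE: "L \<subseteq> E" unfolding LR by (rule adjoin_rat_minimal[OF E(1,3)])
  have embL: "field_emb L \<tau>" using E(4) LE by (auto simp: field_emb_def)
  have RL: "R \<subseteq> L" unfolding LR by (rule subset_adjoin_rat)
  note \<tau> = emb_simps[OF L embL] and cl = subfield_complex_closed[OF L]
  have inj: "inj_on \<tau> L" by (rule emb_inj_on[OF L embL])
  have \<tau>R: "\<tau> ` R \<subseteq> R"
    using poly_Rats_emb[OF L embL F] RL \<tau>(2) by (auto simp: R)
  \<comment> \<open>An injective self-map of a finite set is onto.\<close>
  then have \<tau>R': "\<tau> ` R = R" using finR inj_on_subset[OF inj RL] endo_inj_surj by blast
  \<comment> \<open>Minimality of \<open>L\<close> is used twice: the elements of \<open>L\<close>
    that \<tau> keeps in \<open>L\<close>, and the image of \<open>L\<close>, are both subfields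
    containing \<open>R\<close>, so each contains \<open>L\<close>.\<close>
  have "subfield {z \<in> L. \<tau> z \<in> L} complex_ring"
    by (rule subfield_complexI) (auto simp: \<tau> cl)
  then have "L \<subseteq> {z \<in> L. \<tau> z \<in> L}" unfolding LR
    by (rule adjoin_rat_minimal) (use \<tau>R RL LR in auto)
  moreover have "subfield (\<tau> ` L) complex_ring"
  proof (rule subfield_complexI)
    have I: "w \<in> \<tau> ` L" if "z \<in> L" "\<tau> z = w" for z w using that by blast
    show "1 \<in> \<tau> ` L" by (rule I[of 1]) (auto simp: \<tau> cl)
    show "- w \<in> \<tau> ` L" "inverse w \<in> \<tau> ` L" if "w \<in> \<tau> ` L" for w
      using that by (auto simp: cl \<tau>(5,7)[symmetric])
    show "v + w \<in> \<tau> ` L" "v * w \<in> \<tau> ` L" if "v \<in> \<tau> ` L" "w \<in> \<tau> ` L" for v w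
      using that by (auto simp: cl \<tau>(3,4)[symmetric])
  qed
  then have "L \<subseteq> \<tau> ` L"
    using adjoin_rat_minimal[of "\<tau> ` L" R] \<tau>R' RL unfolding LR by blast
  ultimately have "bij_betw \<tau> L L" using inj by (auto simp: bij_betw_def)
  \<comment> \<open>Elements of \<open>Bij L\<close> are extensional, so \<tau> is cut down to
    \<open>L\<close>.\<close>
  then have "restrict \<tau> L \<in> Bij L" by (simp add: Bij_def bij_betw_restrict_eq)
  moreover have "field_emb L (restrict \<tau> L)" using embL cl by (auto simp: field_emb_def)
  moreover have "restrict \<tau> L x = y" using x E1 E by (simp add: L_def)
  ultimately show ?thesis unfolding carrier_Gal L_def by blast
qed

text \<open>A non-rational algebraic number is moved because its minimal polynomial has a
  second root: the derivative has smaller degree, so it does not vanish there.\<close>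

lemma Gal_fixed_imp_Rats:
  assumes "f \<noteq> 0" and x: "x \<in> splitting_field f"
    and p: "p \<in> polys_over \<rat>" "p \<noteq> 0" "poly p x = 0"
    and fixed: "\<And>\<sigma>. \<sigma> \<in> carrier (Gal f) \<Longrightarrow> \<sigma> x = x"
  shows "x \<in> \<rat>"
proof (rule ccontr)
  assume nr: "x \<notin> \<rat>"
  obtain h where h: "h \<in> polys_over \<rat>" "h \<noteq> 0" "poly h x = 0" and
    min: "\<And>q. q \<in> polys_over \<rat> \<Longrightarrow> q \<noteq> 0 \<Longrightarrow> poly q x = 0 \<Longrightarrow> Polynomial.degree h \<le> Polynomial.degree q"
    using minimal_poly_exists[OF subfield_Rats p] by blast
  have pos: "Polynomial.degree h > 0" by (rule degree_pos_of_root[OF h(2,3)])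
  have "pderiv h \<noteq> 0" using pos by (simp add: pderiv_eq_0_iff)
  moreover have "Polynomial.degree (pderiv h) < Polynomial.degree h" using pos by (simp add: degree_pderiv)
  ultimately have sep: "poly (pderiv h) x \<noteq> 0"
    using min[of "pderiv h"] polys_over_pderiv[OF subfield_Rats h(1)] by force
  obtain g where g: "h = [:-x, 1:] * g" using h(3) by (auto simp: poly_eq_0_iff_dvd)
  \<comment> \<open>A constant cofactor would make \<open>h\<close> linear over the rationals, and
    its root \<open>x\<close> rational.\<close>
  have "Polynomial.degree g \<noteq> 0"
  proof
    assume "Polynomial.degree g = 0"
    then obtain c where c: "g = [:c:]" by (rule degree_eq_zeroE)
    then have hc: "h = [:- x * c, c:]" using g by simp
    then have c0: "c \<noteq> 0" using h(2) by auto
    have "- x * c \<in> \<rat>" "c \<in> \<rat>"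
      using h(1)[unfolded polys_over_def hc, simplified, THEN spec, of 0]
        h(1)[unfolded polys_over_def hc, simplified, THEN spec, of 1] by auto
    then have "- (- x * c / c) \<in> \<rat>" by (intro Rats_minus_iff[THEN iffD2] Rats_divide)
    then show False using nr c0 by simp
  qed
  then obtain y where y: "poly g y = 0"
    using fundamental_theorem_of_algebra constant_degree by metis
  have "y \<noteq> x"
  proof
    assume "y = x"
    then show False using sep y unfolding g pderiv_mult by simp
  qed
  have "poly q y = 0" if "q \<in> polys_over \<rat>" "poly q x = 0" for q
    using minimal_poly_factor[OF subfield_Rats h min that] g y by (metis mult_zero_left mult_zero_right poly_mult)
  then obtain \<sigma> where "\<sigma> \<in> carrier (Gal f)" "\<sigma> x = y"
    using Gal_automorphism_exists[OF assms(1) x p, of y] by blast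
  then show False using fixed \<open>y \<noteq> x\<close> by metis
qed

section \<open>Irreducible polynomials over the rationals and transitivity on their roots\<close>

text \<open>Irreducibility is stated in \<open>rat poly\<close>, while roots and minimal polynomials
  live in \<open>complex poly\<close>; this carries factors back.\<close>

lemma lift_rat_poly:
  assumes "q \<in> polys_over \<rat>"
  obtains Q :: "rat poly" where "map_poly of_rat Q = q"
proof -
  define g :: "complex \<Rightarrow> rat" where "g = inv_into UNIV of_rat"
  have inj: "inj (of_rat :: rat \<Rightarrow> complex)" by (simp add: inj_on_def)
  have g0: "g 0 = 0" using inv_f_f[OF inj, of 0] by (simp add: g_def)
  have "of_rat (g z) = z" if "z \<in> \<rat>" for z
    using that f_inv_into_f[of z of_rat UNIV] by (simp add: g_def Rats_def)
  then have "map_poly of_rat (map_poly g q) = q"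
    using assms g0 by (intro poly_eqI) (simp add: coeff_map_poly polys_over_def)
  then show ?thesis by (rule that)
qed

lemma map_poly_of_rat_mult:
  "map_poly of_rat (P * Q) = map_poly of_rat P * (map_poly of_rat Q :: complex poly)"
  by (intro poly_eqI) (simp add: coeff_map_poly coeff_mult of_rat_sum of_rat_mult)

lemma map_poly_of_rat_eq_iff:
  "map_poly of_rat P = (map_poly of_rat Q :: complex poly) \<longleftrightarrow> P = Q"
  by (simp add: poly_eq_iff coeff_map_poly)

text \<open>Both \<open>f\<close> and \<open>q\<close> are multiples of the minimal polynomial
  \<open>h\<close> of \<open>x\<close>. As \<open>h\<close> is not constant and
  \<open>f = h * s\<close> is irreducible, \<open>s\<close> is a unit, so \<open>f\<close> divides
  whatever \<open>h\<close> divides.\<close>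

lemma irreducible_dvd_poly_over_Rats:
  fixes f :: "int poly"
  assumes irr: "Factorial_Ring.irreducible (map_poly of_int f :: rat poly)"
    and x: "x \<in> complex_roots f" and q: "q \<in> polys_over \<rat>" "poly q x = 0"
  shows "map_poly of_int f dvd q"
proof -
  define P :: "rat poly" where "P = map_poly of_int f"
  have FP: "map_poly of_int f = (map_poly of_rat P :: complex poly)"
    by (simp add: P_def map_poly_map_poly o_def)
  have P0: "P \<noteq> 0" using irr by (auto simp: P_def)
  have F: "map_poly of_int f \<in> polys_over \<rat>" "map_poly of_int f \<noteq> (0 :: complex poly)"
      "poly (map_poly of_int f) x = 0"
    using x P0 map_poly_of_rat_eq_iff[of P 0] of_int_poly_over_Rats[of f]
    by (auto simp: complex_roots_def FP)
  obtain h where h: "h \<in> polys_over \<rat>" "h \<noteq> 0" "poly h x = 0" and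
    min: "\<And>q. q \<in> polys_over \<rat> \<Longrightarrow> q \<noteq> 0 \<Longrightarrow> poly q x = 0 \<Longrightarrow> Polynomial.degree h \<le> Polynomial.degree q"
    using minimal_poly_exists[OF subfield_Rats F] by blast
  obtain s where s: "s \<in> polys_over \<rat>" "map_poly of_int f = h * s"
    using minimal_poly_factor[OF subfield_Rats h min F(1,3)] by blast
  obtain t where t: "t \<in> polys_over \<rat>" "q = h * t"
    using minimal_poly_factor[OF subfield_Rats h min q] by blast
  obtain H S where HS: "map_poly of_rat H = h" "map_poly of_rat S = s"
    using lift_rat_poly h(1) s(1) by metis
  have "map_poly of_rat P = (map_poly of_rat (H * S) :: complex poly)"
    using s(2) by (simp add: FP map_poly_of_rat_mult HS)
  then have PHS: "P = H * S" by (simp only: map_poly_of_rat_eq_iff)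
  have degH: "Polynomial.degree H = Polynomial.degree h" unfolding HS(1)[symmetric]
    by (simp add: degree_map_poly)
  have "\<not> is_unit H"
    using degree_pos_of_root[OF h(2,3)] degH 
    by (metis is_unit_polyE degree_pCons_0 less_irrefl)
  then have "is_unit S" using irr PHS by (auto simp: P_def[symmetric] dest: irreducibleD)
  then obtain S' where "S * S' = 1" by (metis dvdE)
  then have "s * map_poly of_rat S' = 1"
    unfolding HS(2)[symmetric] map_poly_of_rat_mult[symmetric] by simp
  then have "q = map_poly of_int f * (map_poly of_rat S' * t)"
    by (simp add: s(2) t(2) mult.assoc mult.left_commute[of s]) (simp add: mult.commute)
  then show ?thesis by (rule dvdI)
qed

text \<open>At a repeated root the derivative would be a nonzero multiple of the polynomial, yet of
  smaller degree.\<close>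

lemma irreducible_roots_separable:
  fixes f :: "int poly"
  assumes irr: "Factorial_Ring.irreducible (map_poly of_int f :: rat poly)"
  shows "rsquarefree (map_poly of_int f :: complex poly)"
  unfolding rsquarefree_roots
proof (intro allI notI, elim conjE)
  fix x assume x: "poly (map_poly of_int f) x = (0::complex)" and "poly (pderiv (map_poly of_int f)) x = 0"
  let ?F = "map_poly of_int f :: complex poly"
  have F0: "?F \<noteq> 0" using irr by (auto simp: poly_eq_iff coeff_map_poly irreducible_def)
  have deg: "Polynomial.degree ?F > 0" by (rule degree_pos_of_root[OF F0 x])
  have "?F dvd pderiv ?F"
    using x \<open>poly (pderiv ?F) x = 0\<close>
    by (intro irreducible_dvd_poly_over_Rats[OF irr, of x] polys_over_pderiv[OF subfield_Rats] of_int_poly_over_Rats)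
      (auto simp: complex_roots_def)
  moreover have "pderiv ?F \<noteq> 0" using deg by (simp add: pderiv_eq_0_iff)
  ultimately show False using dvd_imp_degree_le[of ?F "pderiv ?F"] deg by (simp add: degree_pderiv)
qed

lemma complex_roots_prod:
  fixes f :: "int poly"
  assumes "Factorial_Ring.irreducible (map_poly of_int f :: rat poly)" and "lead_coeff f = 1"
  shows "map_poly of_int f = (\<Prod>z\<in>complex_roots f. [:- z, 1:])"
    and "card (complex_roots f) = Polynomial.degree f"
proof -
  have deg: "Polynomial.degree (map_poly of_int f :: complex poly) = Polynomial.degree f"
    by (simp add: degree_map_poly)
  show eq: "map_poly of_int f = (\<Prod>z\<in>complex_roots f. [:- z, 1:])"
    using complex_poly_decompose_rsquarefree[OF irreducible_roots_separable[OF assms(1)]] assms(2) deg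
    by (simp add: complex_roots_def coeff_map_poly)
  have "Polynomial.degree f = (\<Sum>z\<in>complex_roots f. Polynomial.degree [:- z, 1:])"
    unfolding deg[symmetric] eq by (rule degree_prod_eq_sum_degree) auto
  then show "card (complex_roots f) = Polynomial.degree f" by simp
qed

lemma complex_roots_subset_splitting_field: "complex_roots f \<subseteq> splitting_field f"
  unfolding splitting_field_def by (rule subset_adjoin_rat)

lemma subfield_splitting_field: "subfield (splitting_field f) complex_ring"
  unfolding splitting_field_def by (rule subfield_adjoin_rat)

lemma Gal_root:
  assumes "\<sigma> \<in> carrier (Gal f)" "x \<in> complex_roots f"
  shows "\<sigma> x \<in> complex_roots f"
proof -
  have e: "field_emb (splitting_field f) \<sigma>" using assms(1) by (simp add: carrier_Gal)
  have x: "x \<in> splitting_field f" using assms(2) complex_roots_subset_splitting_field by blast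
  show ?thesis
    using poly_Rats_emb[OF subfield_splitting_field e of_int_poly_over_Rats[of f] x] assms(2)
      emb_simps(2)[OF subfield_splitting_field e]
    by (simp add: complex_roots_def)
qed

text \<open>A rational polynomial vanishing at \<open>x\<close> is a multiple of \<open>f\<close>,
  hence vanishes at \<open>y\<close>, so \<open>y\<close> is an admissible image of
  \<open>x\<close>.\<close>

lemma Gal_transitive:
  fixes f :: "int poly"
  assumes irr: "Factorial_Ring.irreducible (map_poly of_int f :: rat poly)"
    and x: "x \<in> complex_roots f" and y: "y \<in> complex_roots f"
  shows "\<exists>\<sigma> \<in> carrier (Gal f). \<sigma> x = y"
proof (rule Gal_automorphism_exists[OF _ _ of_int_poly_over_Rats])
  show "f \<noteq> 0" using irr by auto
  show "map_poly of_int f \<noteq> (0 :: complex poly)" using irr by (auto simp: poly_eq_iff coeff_map_poly irreducible_def)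
  show "x \<in> splitting_field f" using x complex_roots_subset_splitting_field by blast
  show "poly (map_poly of_int f) x = 0" using x by (simp add: complex_roots_def)
  fix q assume "q \<in> polys_over \<rat>" "poly q x = 0"
  then have "map_poly of_int f dvd q" by (rule irreducible_dvd_poly_over_Rats[OF irr x])
  then show "poly q y = 0" using y by (auto simp: complex_roots_def dvd_def)
qed

section \<open>Regular action of an abelian group of order 4\<close>

text \<open>For \<open>g\<close> other than the identity, \<open>g^4 = 1\<close>, so either
  \<open>g\<close> or its square is an involution.\<close>

lemma comm_group_order_4_involution:
  assumes "comm_group G" and "Coset.order G = 4"
  obtains s where "s \<in> carrier G" "s \<noteq> \<one>\<^bsub>G\<^esub>" "s \<otimes>\<^bsub>G\<^esub> s = \<one>\<^bsub>G\<^esub>"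
proof -
  interpret G: comm_group G by fact
  have "\<not> carrier G \<subseteq> {\<one>\<^bsub>G\<^esub>}" using assms(2) card_mono[of "{\<one>\<^bsub>G\<^esub>}" "carrier G"] by (auto simp: Coset.order_def)
  then obtain g where g: "g \<in> carrier G" "g \<noteq> \<one>\<^bsub>G\<^esub>" by blast
  have "(g \<otimes>\<^bsub>G\<^esub> g) \<otimes>\<^bsub>G\<^esub> (g \<otimes>\<^bsub>G\<^esub> g) = g [^]\<^bsub>G\<^esub> (4::nat)"
    using g by (simp add: numeral_eq_Suc G.m_assoc)
  also have "\<dots> = \<one>\<^bsub>G\<^esub>" using G.pow_order_eq_1[OF g(1)] assms(2) by simp
  finally show ?thesis using that[of g] that[of "g \<otimes>\<^bsub>G\<^esub> g"] g by auto
qed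

text \<open>Transitivity of 4 elements on 4 roots makes the action regular. The involution
  \<open>s\<close> splits the roots into two pairs, and \<open>t\<close>, commuting with
  \<open>s\<close>, exchanges the pairs. In the first alternative \<open>t\<close> is an involution;
  in the second it is the 4-cycle \<open>x1, x3, x2, x4\<close>.\<close>

lemma Gal_order_4_roots:
  fixes f :: "int poly"
  assumes irr: "Factorial_Ring.irreducible (map_poly of_int f :: rat poly)"
    and monic: "lead_coeff f = 1" and deg: "Polynomial.degree f = 4"
    and G: "comm_group (Gal f)" "Coset.order (Gal f) = 4"
  obtains x1 x2 x3 x4 s t where "complex_roots f = {x1, x2, x3, x4}" "distinct [x1, x2, x3, x4]"
    and "s \<in> carrier (Gal f)" "t \<in> carrier (Gal f)"
    and "s x1 = x2" "s x2 = x1" "s x3 = x4" "s x4 = x3" "t x1 = x3" "t x2 = x4"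
    and "t x3 = x1 \<and> t x4 = x2 \<or> t x3 = x2 \<and> t x4 = x1"
    and "\<forall>z\<in>splitting_field f. s z = z \<longrightarrow> t z = z \<longrightarrow> (\<forall>g\<in>carrier (Gal f). g z = z)"
proof -
  let ?G = "Gal f" and ?R = "complex_roots f"
  interpret G: comm_group ?G by (rule G(1))
  note RL = subsetD[OF complex_roots_subset_splitting_field[of f]]
  have cR: "card ?R = 4" using complex_roots_prod(2)[OF irr monic] deg by simp
  then have fR: "finite ?R" by (intro card_ge_0_finite) simp
  have cG: "card (carrier ?G) = 4" using G(2) by (simp add: Coset.order_def)
  then have fG: "finite (carrier ?G)" by (intro card_ge_0_finite) simp
  \<comment> \<open>Evaluation at a root maps a 4-element set onto a 4-element set, hence is
    injective.\<close>
  have inj: "inj_on (\<lambda>g. g x) (carrier ?G)" if "x \<in> ?R" for x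
  proof (rule eq_card_imp_inj_on[OF fG])
    have "(\<lambda>g. g x) ` carrier ?G = ?R"
      using Gal_transitive[OF irr that] Gal_root that by fast
    then show "card ((\<lambda>g. g x) ` carrier ?G) = card (carrier ?G)" using cR cG by simp
  qed
  have m: "(g \<otimes>\<^bsub>?G\<^esub> h) x = g (h x)" if "g \<in> carrier ?G" "h \<in> carrier ?G" "x \<in> ?R" for g h x
    using mult_Gal that RL by blast
  have free: "g = \<one>\<^bsub>?G\<^esub>" if "g \<in> carrier ?G" "x \<in> ?R" "g x = x" for g x
    using inj_onD[OF inj[OF that(2)], of g "\<one>\<^bsub>?G\<^esub>"] that one_Gal RL by simp
  have ginj: "x = y" if "g \<in> carrier ?G" "x \<in> ?R" "y \<in> ?R" "g x = g y" for g x y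
    using that RL by (auto simp: carrier_Gal Bij_def bij_betw_def dest: inj_onD)
  obtain s where s: "s \<in> carrier ?G" "s \<noteq> \<one>\<^bsub>?G\<^esub>" "s \<otimes>\<^bsub>?G\<^esub> s = \<one>\<^bsub>?G\<^esub>"
    using comm_group_order_4_involution[OF G] by blast
  have ss: "s (s x) = x" if "x \<in> ?R" for x
    using m[OF s(1) s(1) that] s(3) one_Gal[OF RL[OF that]] by simp
  have sne: "s x \<noteq> x" if "x \<in> ?R" for x using free[OF s(1) that] s(2) by blast
  have sR: "s x \<in> ?R" if "x \<in> ?R" for x using Gal_root[OF s(1) that] .
  obtain x1 where x1: "x1 \<in> ?R" using cR by (metis all_not_in_conv card.empty zero_neq_numeral)
  define x2 where "x2 = s x1"
  have x2: "x2 \<in> ?R" using sR x1 by (simp add: x2_def)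
  have "\<not> ?R \<subseteq> {x1, x2}"
  proof
    assume "?R \<subseteq> {x1, x2}"
    then have "card ?R \<le> card {x1, x2}" by (intro card_mono) auto
    also have "\<dots> \<le> 2" by (simp add: card_insert_if)
    finally show False using cR by simp
  qed
  then obtain x3 where x3: "x3 \<in> ?R" "x3 \<noteq> x1" "x3 \<noteq> x2" by blast
  define x4 where "x4 = s x3"
  have x4: "x4 \<in> ?R" using sR x3 by (simp add: x4_def)
  have s': "s x1 = x2" "s x2 = x1" "s x3 = x4" "s x4 = x3" using ss x1 x3 by (simp_all add: x2_def x4_def)
  have dist: "distinct [x1, x2, x3, x4]"
    using sne[OF x1] sne[OF x3(1)] x3 s' ss[OF x1] by auto
  have R: "?R = {x1, x2, x3, x4}"
    by (rule card_subset_eq[symmetric, OF fR]) (use x1 x2 x3 x4 dist cR in auto)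
  obtain t where t: "t \<in> carrier ?G" "t x1 = x3" using Gal_transitive[OF irr x1 x3(1)] by blast
  have ts: "t (s x) = s (t x)" if "x \<in> ?R" for x
    using m[OF s(1) t(1) that] m[OF t(1) s(1) that] G.m_comm[OF s(1) t(1)] by simp
  have t2: "t x2 = x4" using ts[OF x1] s' t by simp
  have "t x3 \<in> ?R" by (rule Gal_root[OF t(1) x3(1)])
  moreover have "t x3 \<noteq> x3" "t x3 \<noteq> x4"
    using ginj[OF t(1) x3(1) x1] ginj[OF t(1) x3(1) x2] t t2 dist by auto
  ultimately have t34: "t x3 = x1 \<and> t x4 = x2 \<or> t x3 = x2 \<and> t x4 = x1"
    using ts[OF x3(1)] s' R by auto
  \<comment> \<open>By regularity \<open>g\<close> is determined by \<open>g x1\<close>, which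
    leaves only the identity, \<open>s\<close>, \<open>t\<close> and their product.\<close>
  have fixed: "g z = z" if z: "z \<in> splitting_field f" "s z = z" "t z = z" and g: "g \<in> carrier ?G" for z g
  proof -
    have eq: "g = h" if "h \<in> carrier ?G" "g x1 = h x1" for h
      using inj_onD[OF inj[OF x1]] that g by blast
    consider "g x1 = x1" | "g x1 = x2" | "g x1 = x3" | "g x1 = x4" using Gal_root[OF g x1] R by blast
    then have "g = \<one>\<^bsub>?G\<^esub> \<or> g = s \<or> g = t \<or> g = s \<otimes>\<^bsub>?G\<^esub> t"
    proof cases
      case 1
      then show ?thesis using eq[OF G.one_closed] one_Gal[OF RL[OF x1]] by simp
    next
      case 2
      then show ?thesis using eq[OF s(1)] s'(1) by simp
    next
      case 3
      then show ?thesis using eq[OF t(1)] t(2) by simp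
    next
      case 4
      then show ?thesis using eq[OF G.m_closed[OF s(1) t(1)]] m[OF s(1) t(1) x1] t(2) s'(3) by simp
    qed
    then show ?thesis using z(2,3) one_Gal[OF z(1)] mult_Gal[OF s(1) t(1) z(1)] by (elim disjE) simp_all
  qed
  show ?thesis
    by (rule that[of x1 x2 x3 x4 s t, OF R dist s(1) t(1) s' t(2) t2 t34]) (use fixed in blast)
qed

section \<open>The quartic\<close>

text \<open>Each prime occurs in \<open>d\<close> at most once, and a prime dividing
  \<open>d\<close> divides the power of \<open>r\<close>, hence \<open>r\<close>.\<close>

lemma squarefree_dvd_power_imp_dvd:
  fixes d r :: "'a :: factorial_semiring_multiplicative"
  assumes "squarefree d" "d dvd r ^ n"
  shows "d dvd r"
proof (cases "r = 0")
  case False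
  have d0: "d \<noteq> 0" using assms by auto
  show ?thesis
  proof (rule multiplicity_le_imp_dvd[OF d0])
    fix p :: 'a assume p: "prime p"
    show "multiplicity p d \<le> multiplicity p r"
    proof (cases "p dvd d")
      case True
      then have "p dvd r" using assms p by (meson dvd_trans prime_dvd_power)
      then have "multiplicity p r \<ge> 1" using False p by (intro multiplicity_geI) auto
      moreover have "multiplicity p d \<le> 1" using assms(1) p d0 by (simp add: squarefree_factorial_semiring'')
      ultimately show ?thesis by simp
    qed (simp add: not_dvd_imp_multiplicity_0)
  qed
qed simp

text \<open>With \<open>d = x^2 * k\<close>, the quotient \<beta> of \<theta>^3 + a\<theta>^2 by
  \<open>x\<close> satisfies \<theta>\<beta> = -xk. Substituting \<theta> = -xk/\<beta> into the
  quartic gives a monic integer equation for \<beta>, so \<beta> has integer coordinates in the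
  power basis.\<close>

lemma quartic_squarefree_const:
  fixes a d :: int and f :: "int poly"
  assumes d0: "d \<noteq> 0" and f: "f = Polynomial.monom 1 4 + Polynomial.monom a 3 + [:d:]"
    and deg: "Polynomial.degree f = 4" and mono: "monogenic f"
  shows "squarefree d"
proof (rule squarefreeI)
  fix x :: int assume "x\<^sup>2 dvd d"
  then obtain k where k: "d = x\<^sup>2 * k" by blast
  have x0: "x \<noteq> 0" "k \<noteq> 0" using k d0 by auto
  obtain \<theta> where \<theta>: "\<theta> \<in> complex_roots f"
    and basis: "int_basis 4 (\<lambda>i. \<theta> ^ i) (ring_of_integers (adjoin_rat {\<theta>}))"
    using mono deg by (auto simp: monogenic_def)
  define u A D K where "u = complex_of_int x" and "A = complex_of_int a" and "D = complex_of_int d" and "K = complex_of_int k"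
  have Du: "D = u\<^sup>2 * K" using k by (simp add: D_def u_def K_def)
  have u0: "u \<noteq> 0" using x0 by (simp add: u_def)
  have "map_poly of_int f = Polynomial.monom 1 4 + Polynomial.monom A 3 + [:D:]"
    unfolding f by (intro poly_eqI) (simp add: coeff_map_poly coeff_pCons A_def D_def split: nat.splits)
  then have root: "\<theta>^4 + A * \<theta>^3 + D = 0"
    using \<theta> by (simp add: complex_roots_def poly_monom)
  have \<theta>0: "\<theta> \<noteq> 0" using root d0 by (auto simp: D_def)
  define \<beta> where "\<beta> = (\<theta>^3 + A * \<theta>^2) * inverse u"
  have "u * (\<theta> * \<beta>) = - D" using root u0 by (simp add: \<beta>_def field_simps eval_nat_numeral) (simp add: eq_neg_iff_add_eq_0 algebra_simps)
  also have "\<dots> = u * (- (u * K))" by (simp add: Du power2_eq_square)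
  finally have \<theta>\<beta>: "\<theta> * \<beta> = - (u * K)" using u0 by (simp only: mult_cancel_left) simp
  \<comment> \<open>The factor \<theta>^4 pairs every \<beta> with a \<theta>, so that the product
    \<theta>\<beta> can be replaced throughout.\<close>
  have "\<theta>^4 * (\<beta>^4 - A * u * K^2 * \<beta> + u^2 * K^3) = (\<theta> * \<beta>)^4 - A * u * K^2 * (\<theta> * \<beta>) * \<theta>^3 + u^2 * K^3 * \<theta>^4"
    by (simp add: algebra_simps eval_nat_numeral)
  also have "\<dots> = u^2 * K^3 * (\<theta>^4 + A * \<theta>^3 + D)"
    unfolding \<theta>\<beta> Du by (simp add: algebra_simps eval_nat_numeral)
  finally have \<beta>eq: "\<beta>^4 - A * u * K^2 * \<beta> + u^2 * K^3 = 0" using root \<theta>0 by simp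
  have "algebraic_int \<beta>" unfolding algebraic_int_altdef_ipoly
    by (rule exI[of _ "[:x^2 * k^3, - (a * x * k^2), 0, 0, 1:]"])
      (use \<beta>eq in \<open>simp add: map_poly_pCons A_def u_def K_def eval_nat_numeral algebra_simps\<close>)
  moreover have "\<beta> \<in> adjoin_rat {\<theta>}"
  proof -
    note cl = subfield_complex_closed[OF subfield_adjoin_rat[of "{\<theta>}"]]
    have "\<theta> \<in> adjoin_rat {\<theta>}" using subset_adjoin_rat by blast
    moreover have "u \<in> adjoin_rat {\<theta>}" "A \<in> adjoin_rat {\<theta>}" 
      unfolding u_def A_def by (rule of_int_in_adjoin_rat)+
    ultimately show ?thesis unfolding \<beta>_def power2_eq_square power3_eq_cube by (intro cl)
  qed
  ultimately have "\<beta> \<in> ring_of_integers (adjoin_rat {\<theta>})" by (simp add: ring_of_integers_def)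
  then obtain c :: "nat \<Rightarrow> int" where c: "\<beta> = (\<Sum>i<4. of_int (c i) * \<theta> ^ i)"
    using basis by (auto simp: int_basis_def)
  \<comment> \<open>These are the coordinates of x\<beta> - (\<theta>^3 + a\<theta>^2), which is
    zero; the one at \<theta>^3 shows that \<open>x\<close> is a unit.\<close>
  define c' where "c' i = x * c i - (if i = 3 then 1 else if i = 2 then a else 0)" for i :: nat
  have sum4: "(\<Sum>i<4. g i) = g 0 + g 1 + g 2 + g 3" for g :: "nat \<Rightarrow> complex"
    by (simp add: eval_nat_numeral)
  have "(\<Sum>i<4. of_int (c' i) * \<theta> ^ i) = u * \<beta> - (\<theta>^3 + A * \<theta>^2)"
    unfolding c sum4 by (simp add: c'_def u_def A_def algebra_simps)
  also have "\<dots> = 0" using u0 by (simp add: \<beta>_def)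
  finally have "(\<Sum>i<4. of_int (c' i) * \<theta> ^ i) = 0" .
  then have "\<forall>i<4. c' i = 0" using basis by (simp add: int_basis_def)
  then have "c' 3 = 0" by simp
  then have "1 = x * c 3" by (simp add: c'_def)
  then show "x dvd 1" by (rule dvdI)
qed

section \<open>The integer equation for the resolvent root\<close>

lemma int_square_le_24:
  assumes "(x::int)\<^sup>2 \<le> 24" shows "x \<in> {-4, -3, -2, -1, 0, 1, 2, 3, 4}"
proof -
  have "\<bar>x\<bar> < 5"
  proof (rule ccontr)
    assume "\<not> \<bar>x\<bar> < 5"
    then have "5\<^sup>2 \<le> \<bar>x\<bar>\<^sup>2" by (intro power_mono) auto
    then show False using assms by simp
  qed
  then have "x \<in> {-4..4}" by auto
  also have "{-4..4} = {-4, -3, -2, -1, 0, 1, 2, 3, 4::int}" by auto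
  finally show ?thesis .
qed

text \<open>With \<open>r = d * s\<close> and \<open>m = d * s^2\<close> the cubic becomes
  \<open>a^2 = d * s * (m - 4)\<close>, and the two hypotheses become conditions on the sign of
  \<open>16 - 3 * m\<close>. Only small \<open>m\<close> survive.\<close>

lemma quartic_resolvent_int:
  fixes a d r :: int
  assumes "squarefree d" "a \<noteq> 0" and r: "r^3 = 4 * d * r + a^2 * d"
  shows "16 * d - 3 * r^2 = w^2 \<Longrightarrow> w \<noteq> 0 \<Longrightarrow> False"
    and "(16 * d - 3 * r^2) * (r^2 - 4 * d) > 0 \<Longrightarrow> False"
proof -
  have d0: "d \<noteq> 0" using assms(1) by auto
  have "d dvd r ^ 3" unfolding r by (simp add: algebra_simps)
  then have "d dvd r" by (rule squarefree_dvd_power_imp_dvd[OF assms(1)])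
  then obtain s where s: "r = d * s" by blast
  define m where "m = d * s^2"
  have "d * (d * s * (m - 4)) = d * a^2"
    using r unfolding s m_def by (simp add: algebra_simps eval_nat_numeral)
  then have a2: "a^2 = d * s * (m - 4)" using d0 by simp
  \<comment> \<open>Here \<open>d\<close> is positive, so \<open>s^2\<close> is a nonzero square at
    most 5, that is 1 or 4.\<close>
  have sq: "s\<^sup>2 = 1" "m = d" if "0 < m" "m \<le> 5" "s\<^sup>2 \<noteq> 4"
  proof -
    have "d > 0" using that by (auto simp: m_def zero_less_mult_iff)
    moreover have "s \<noteq> 0" using that by (auto simp: m_def)
    ultimately have "1 * s\<^sup>2 \<le> m" unfolding m_def by (intro mult_right_mono) auto
    then have "s\<^sup>2 \<le> 5" using that by simp
    then have "s \<in> {-4, -3, -2, -1, 0, 1, 2, 3, 4}" by (intro int_square_le_24) simp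
    then show "s\<^sup>2 = 1" using \<open>s\<^sup>2 \<le> 5\<close> \<open>s \<noteq> 0\<close> \<open>s\<^sup>2 \<noteq> 4\<close> by auto
    then show "m = d" by (simp add: m_def)
  qed
  have nsq: "x\<^sup>2 \<noteq> 3" "x\<^sup>2 \<noteq> 5" "x\<^sup>2 \<noteq> 20" for x :: int using int_square_le_24[of x] by auto
  have apos: "a\<^sup>2 > 0" using assms(2) by simp
  have m5: False if "m = 5"
  proof -
    have "s\<^sup>2 \<noteq> 4"
    proof
      assume "s\<^sup>2 = 4"
      then have "d * 4 = 5" using that by (simp add: m_def)
      then show False by presburger
    qed
    then have "s\<^sup>2 = 1" "d = 5" using sq that by auto
    then show False using a2 that apos nsq(2)[of a] by (auto simp: power2_eq_1_iff)
  qed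
  show False if "16 * d - 3 * r^2 = w^2" "w \<noteq> 0"
  proof -
    have "w\<^sup>2 = d * (16 - 3 * m)" using that(1) by (simp add: s m_def algebra_simps eval_nat_numeral)
    then have pos: "d * (16 - 3 * m) > 0"
      using zero_less_power2[of w] that(2) by metis
    have "d > 0"
    proof (rule ccontr)
      assume "\<not> d > 0"
      then have "m \<le> 0" unfolding m_def by (intro mult_nonpos_nonneg) auto
      then have "d * (16 - 3 * m) \<le> 0" using \<open>\<not> d > 0\<close> by (intro mult_nonpos_nonneg) auto
      then show False using pos by simp
    qed
    then have m: "m \<le> 5" using zero_less_mult_pos[OF pos] by simp
    have "s \<noteq> 0" using a2 apos by auto
    then have "m > 0" using \<open>d > 0\<close> by (simp add: m_def)
    \<comment> \<open>Otherwise \<open>m\<close> is a multiple of 4 between 1 and 5, so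
      \<open>m = 4\<close> and \<open>a\<close> vanishes.\<close>
    have "s\<^sup>2 \<noteq> 4"
    proof
      assume "s\<^sup>2 = 4"
      then have "m = d * 4" by (simp add: m_def)
      then have "m = 4" using m \<open>m > 0\<close> by presburger
      then show False using a2 apos by simp
    qed
    then have s1: "s\<^sup>2 = 1" and md: "m = d" using sq m \<open>m > 0\<close> by auto
    \<comment> \<open>Since \<open>s\<close> is 1 or -1, the values 1, 3, 5 of \<open>d\<close>
      would make 3, 3, 5 a square, and 4 would make \<open>a\<close> zero. The remaining
      \<open>d = 2\<close> gives \<open>w^2 = 20\<close>.\<close>
    have "d \<in> {1, 2, 3, 4, 5}" using m \<open>d > 0\<close> md by auto
    then have "d = 2" using a2 apos s1 nsq[of a] md by (auto simp: power2_eq_1_iff)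
    then show False using \<open>w\<^sup>2 = d * (16 - 3 * m)\<close> md nsq(3)[of w] by simp
  qed
  show False if "(16 * d - 3 * r^2) * (r^2 - 4 * d) > 0"
  proof -
    have "(16 * d - 3 * r^2) * (r^2 - 4 * d) = d^2 * ((16 - 3 * m) * (m - 4))"
      by (simp add: s m_def algebra_simps eval_nat_numeral)
    then have "0 < d\<^sup>2 * ((16 - 3 * m) * (m - 4))" using that by simp
    then have "(16 - 3 * m) * (m - 4) > 0" by (rule zero_less_mult_pos) (use d0 in simp)
    \<comment> \<open>The integer \<open>m\<close> lies strictly between 4 and 16/3.\<close>
    then have "m = 5" unfolding zero_less_mult_iff by presburger
    then show False by (rule m5)
  qed
qed

section \<open>Root identities and the contradiction\<close>

lemma quartic_eq_pCons:
  "Polynomial.monom 1 4 + Polynomial.monom a 3 + [:d:] = [:d, 0, 0, a, 1:]"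
  by (rule poly_eqI) (auto simp: coeff_pCons numeral_eq_Suc split: nat.splits)

text \<open>Both groups of the theorem are treated at once: of the Galois group only commutativity
  and order 4 enter.\<close>

lemma monogenic_quartic_not_abelian_order_4:
  fixes a d :: int and f :: "int poly"
  assumes "a * d \<noteq> 0"
    and f: "f = Polynomial.monom 1 4 + Polynomial.monom a 3 + [:d:]"
    and mono: "monogenic f"
    and G: "comm_group (Gal f)" "Coset.order (Gal f) = 4"
  shows False
proof -
  have fp: "f = [:d, 0, 0, a, 1:]" unfolding f by (rule quartic_eq_pCons)
  have deg: "Polynomial.degree f = 4" and lead: "lead_coeff f = 1" and f0: "f \<noteq> 0" by (simp_all add: fp)
  have irr: "Factorial_Ring.irreducible (map_poly of_int f :: rat poly)"
    using mono by (simp add: monogenic_def)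
  have a0: "a \<noteq> 0" and d0: "d \<noteq> 0" using assms(1) by auto
  have sqf: "squarefree d" by (rule quartic_squarefree_const[OF d0 f deg mono])
  obtain x1 x2 x3 x4 s t where R: "complex_roots f = {x1, x2, x3, x4}" and dist: "distinct [x1, x2, x3, x4]"
    and st: "s \<in> carrier (Gal f)" "t \<in> carrier (Gal f)"
    and s: "s x1 = x2" "s x2 = x1" "s x3 = x4" "s x4 = x3" and t: "t x1 = x3" "t x2 = x4"
    and t34: "t x3 = x1 \<and> t x4 = x2 \<or> t x3 = x2 \<and> t x4 = x1"
    and fixed: "\<forall>z\<in>splitting_field f. s z = z \<longrightarrow> t z = z \<longrightarrow> (\<forall>g\<in>carrier (Gal f). g z = z)"
    by (rule Gal_order_4_roots[OF irr lead deg G], rule that, assumption+)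
  define L where "L = splitting_field f"
  have L: "subfield L complex_ring" by (simp add: L_def subfield_splitting_field)
  note cl = subfield_complex_closed[OF L]
  have xL: "x1 \<in> L" "x2 \<in> L" "x3 \<in> L" "x4 \<in> L"
    using complex_roots_subset_splitting_field[of f] by (auto simp: R L_def)
  have es: "field_emb L s" and et: "field_emb L t" using st by (auto simp: carrier_Gal L_def)
  note s_simps = emb_simps[OF L es] and t_simps = emb_simps[OF L et]
  \<comment> \<open>Elements fixed by \<open>s\<close> and \<open>t\<close> are fixed by the whole
    group, hence rational; a monic integer equation then makes them integers.\<close>
  have rat: "z \<in> \<rat>" if "z \<in> L" "s z = z" "t z = z" "p \<noteq> 0" "poly (map_poly of_int p) z = 0" for z p
  proof (rule Gal_fixed_imp_Rats[OF f0 _ of_int_poly_over_Rats])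
    show "map_poly of_int p \<noteq> (0 :: complex poly)" using that(4) by (simp add: poly_eq_iff coeff_map_poly)
  qed (use that fixed in \<open>auto simp: L_def\<close>)
  have int: "z \<in> \<int>" if "z \<in> L" "s z = z" "t z = z" "lead_coeff p = 1" "poly (map_poly of_int p) z = 0" for z p
  proof (rule rational_algebraic_int_is_int)
    show "algebraic_int z" using that(4,5) by (auto simp: algebraic_int_altdef_ipoly)
    have "p \<noteq> 0" using that(4) by auto
    then show "z \<in> \<rat>" by (rule rat[OF that(1-3) _ that(5)])
  qed

  define A D where "A = complex_of_int a" and "D = complex_of_int d"
  have AD: "A \<noteq> 0" "D \<noteq> 0" using a0 d0 by (simp_all add: A_def D_def)
  \<comment> \<open>Over the splitting field the quartic factors as
    \<open>(X^2 - S1 X + P1) (X^2 - S2 X + P2)\<close>, one factor for each orbit of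
    \<open>s\<close>.\<close>
  define S1 S2 P1 P2 where "S1 = x1 + x2" and "S2 = x3 + x4" and "P1 = x1 * x2" and "P2 = x3 * x4"
  note SP = S1_def S2_def P1_def P2_def
  have "[:D, 0, 0, A, 1:] = (\<Prod>z\<in>{x1, x2, x3, x4}. [:- z, 1:])"
    using complex_roots_prod(1)[OF irr lead, unfolded R] by (simp add: fp map_poly_pCons A_def D_def)
  also have "\<dots> = [:- x1, 1:] * ([:- x2, 1:] * ([:- x3, 1:] * [:- x4, 1:]))" using dist by simp
  also have "\<dots> = [:P1 * P2, - (S1 * P2 + S2 * P1), P1 + P2 + S1 * S2, - (S1 + S2), 1:]"
    by (simp add: SP algebra_simps)
  finally have vieta: "P1 * P2 = D" "S1 * P2 + S2 * P1 = 0" "P1 + P2 + S1 * S2 = 0" "S1 + S2 = - A"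
    by (auto simp: add_eq_0_iff)
  define R' where "R' = P1 + P2"
  have S12: "S1 * S2 = - R'" using vieta(3) by (simp add: R'_def eq_neg_iff_add_eq_0 algebra_simps)
  have diff: "(P1 - P2)\<^sup>2 = R'\<^sup>2 - 4 * D"
    unfolding R'_def vieta(1)[symmetric] by (simp add: power2_eq_square algebra_simps)
  \<comment> \<open>This is the resolvent cubic. Vanishing of the linear coefficient expresses
    \<open>S1 * (P2 - P1)\<close> and \<open>S2 * (P1 - P2)\<close> through \<open>A\<close>,
    \<open>P1\<close>, \<open>P2\<close>; multiplying the two expressions gives the
    equation.\<close>
  have cubic: "R'^3 = 4 * D * R' + A\<^sup>2 * D"
  proof -
    have "S1 * (P2 - P1) = (S1 * P2 + S2 * P1) - (S1 + S2) * P1" by (simp add: algebra_simps)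
    then have 1: "S1 * (P2 - P1) = A * P1" by (simp add: vieta)
    have "S2 * (P1 - P2) = (S1 * P2 + S2 * P1) - (S1 + S2) * P2" by (simp add: algebra_simps)
    then have 2: "S2 * (P1 - P2) = A * P2" by (simp add: vieta)
    have "(S1 * (P2 - P1)) * (S2 * (P1 - P2)) = - (S1 * S2) * (P1 - P2)\<^sup>2"
      by (simp add: algebra_simps power2_eq_square)
    then have "(A * P1) * (A * P2) = R' * (R'\<^sup>2 - 4 * D)" by (simp add: 1 2 S12 diff)
    moreover have "(A * P1) * (A * P2) = A\<^sup>2 * D"
      unfolding vieta(1)[symmetric] by (simp add: power2_eq_square)
    ultimately have "A\<^sup>2 * D = R' * (R'\<^sup>2 - 4 * D)" by simp
    then show ?thesis by (simp add: algebra_simps power2_eq_square power3_eq_cube)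
  qed
  have R'L: "R' \<in> L" using xL by (auto simp: R'_def P1_def P2_def intro!: cl)
  have sP: "s P1 = P1" "s P2 = P2" using xL by (simp_all add: P1_def P2_def s_simps s mult.commute)
  have tP: "t P1 = P2" "t P2 = P1"
    using t34 xL by (auto simp: P1_def P2_def t_simps t mult.commute)
  have PL: "P1 \<in> L" "P2 \<in> L" using xL by (auto simp: P1_def P2_def intro!: cl)
  have "R' \<in> \<int>"
  proof (rule int[of _ "[:- (a\<^sup>2 * d), - (4 * d), 0, 1:]"])
    show "s R' = R'" "t R' = R'" using PL by (simp_all add: R'_def s_simps t_simps sP tP add.commute)
    show "poly (map_poly of_int [:- (a\<^sup>2 * d), - (4 * d), 0, 1:]) R' = 0"
      using cubic by (simp add: map_poly_pCons A_def D_def power3_eq_cube algebra_simps)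
  qed (use R'L in auto)
  then obtain r where r: "R' = of_int r" by (auto elim: Ints_cases)
  have "of_int (r^3) = (of_int (4 * d * r + a\<^sup>2 * d) :: complex)"
    using cubic by (simp add: r A_def D_def)
  then have rint: "r^3 = 4 * d * r + a\<^sup>2 * d" by (simp only: of_int_eq_iff)
  note no = quartic_resolvent_int[OF sqf a0 rint]

  \<comment> \<open>Each factor squares to the discriminant of one quadratic factor. Since
    \<open>s\<close> negates both factors, it fixes \<open>w\<close>.\<close>
  define w where "w = (x1 - x2) * (x3 - x4)"
  have wL: "w \<in> L" using xL by (auto simp: w_def intro!: cl)
  have w0: "w \<noteq> 0" using dist by (simp add: w_def)
  have sw: "s w = w" using xL by (simp add: w_def s_simps s cl) (simp add: algebra_simps)
  have w2: "w\<^sup>2 = of_int (16 * d - 3 * r\<^sup>2)"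
  proof -
    have "w\<^sup>2 = (S1 * S2)\<^sup>2 - 4 * (S1 * (S1 * P2) + S2 * (S2 * P1)) + 16 * (P1 * P2)"
      by (simp add: w_def SP power2_eq_square algebra_simps)
    also have "S1 * (S1 * P2) + S2 * (S2 * P1) = (S1 + S2) * (S1 * P2 + S2 * P1) - S1 * S2 * (P1 + P2)"
      by (simp add: algebra_simps)
    also have "\<dots> = R'\<^sup>2" by (simp add: vieta S12 R'_def[symmetric] power2_eq_square)
    also have "(S1 * S2)\<^sup>2 - 4 * R'\<^sup>2 + 16 * (P1 * P2) = 16 * D - 3 * R'\<^sup>2"
      by (simp add: S12 vieta)
    finally show ?thesis by (simp add: r D_def)
  qed
  from t34 show False
  proof
    \<comment> \<open>Noncyclic case: \<open>t\<close> interchanges the two factors of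
      \<open>w\<close>.\<close>
    assume t': "t x3 = x1 \<and> t x4 = x2"
    have "w \<in> \<int>"
    proof (rule int[OF wL sw, of "[:- (16 * d - 3 * r\<^sup>2), 0, 1:]"])
      show "t w = w" using xL t' by (simp add: w_def t_simps t cl mult.commute)
      show "poly (map_poly of_int [:- (16 * d - 3 * r\<^sup>2), 0, 1:]) w = 0"
        using w2 by (simp add: map_poly_pCons power2_eq_square)
    qed simp
    then obtain k where k: "w = of_int k" by (auto elim: Ints_cases)
    have "of_int (16 * d - 3 * r\<^sup>2) = (of_int (k\<^sup>2) :: complex)" using w2 by (simp add: k)
    then have "16 * d - 3 * r\<^sup>2 = k\<^sup>2" by (simp only: of_int_eq_iff)
    then show False using no(1) w0 k by auto
  next
    \<comment> \<open>Cyclic case: \<open>t\<close> negates both \<open>w\<close> and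
      \<open>P1 - P2\<close>, so their product is fixed. Rationality is enough here, as only the
      sign of its square \<open>n\<close> matters.\<close>
    assume t': "t x3 = x2 \<and> t x4 = x1"
    define n where "n = (16 * d - 3 * r\<^sup>2) * (r\<^sup>2 - 4 * d)"
    define v where "v = w * (P1 - P2)"
    have vL: "v \<in> L" using wL PL by (auto simp: v_def intro!: cl)
    have tw: "t w = - w" using xL t' by (simp add: w_def t_simps t cl) (simp add: algebra_simps)
    have v2: "v\<^sup>2 = of_int n"
      unfolding v_def n_def power_mult_distrib w2 diff by (simp add: r D_def)
    have "v \<in> \<rat>"
    proof (rule rat[OF vL, of "[:- n, 0, 1:]"])
      show "s v = v" using wL PL by (simp add: v_def s_simps cl sw sP)
      show "t v = v" using wL PL by (simp add: v_def t_simps cl tw tP algebra_simps)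
      show "poly (map_poly of_int [:- n, 0, 1:]) v = 0"
        using v2 by (simp add: map_poly_pCons power2_eq_square)
    qed simp
    then obtain q where q: "v = of_rat q" by (auto elim: Rats_cases)
    \<comment> \<open>This keeps \<open>v\<close> nonzero, so that \<open>n\<close> is strictly
      positive.\<close>
    have "P1 \<noteq> P2"
    proof
      assume "P1 = P2"
      then have "(S1 + S2) * P1 = 0" using vieta(2) by (simp add: algebra_simps)
      then show False using vieta(1,4) AD by auto
    qed
    then have "q \<noteq> 0" using w0 q by (auto simp: v_def)
    have "of_rat (q\<^sup>2) = (of_rat (of_int n) :: complex)" using v2 by (simp add: q of_rat_power)
    then have "q\<^sup>2 = of_int n" by (simp only: of_rat_eq_iff)
    then have "n > 0" using \<open>q \<noteq> 0\<close> by (metis of_int_0_less_iff zero_less_power2)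
    then show False using no(2) by (simp add: n_def)
  qed
qed

theorem corollary1p2:
  fixes a d :: int and f :: "int poly"
  assumes "a * d \<noteq> 0"
    and "f = Polynomial.monom 1 4 + Polynomial.monom a 3 + [:d:]"
    and "monogenic f"
  shows "\<not> (Gal f \<cong> integer_mod_group 2 \<times>\<times> integer_mod_group 2) \<and>
    \<not> (Gal f \<cong> integer_mod_group 4)"
proof -
  \<comment> \<open>The element type of \<open>H\<close> is left open because the two target groups
    have carriers of different types.\<close>
  have no: False if iso: "Gal f \<cong> H" and H: "comm_group H" "Coset.order H = 4" for H :: "'x monoid"
  proof (rule monogenic_quartic_not_abelian_order_4[OF assms])
    interpret G: group "Gal f" by (rule group_Gal)
    have "H \<cong> Gal f" by (rule G.iso_sym[OF iso])
    then show "comm_group (Gal f)"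
      by (rule comm_group.iso_imp_comm_group[OF H(1)]) unfold_locales
    show "Coset.order (Gal f) = 4" using iso_same_card[OF iso] H(2) by (simp add: Coset.order_def)
  qed
  have "comm_group (integer_mod_group 2 \<times>\<times> integer_mod_group 2)"
    by (rule group.group_comm_groupI[OF DirProd_group]) (auto simp: add.commute)
  moreover have "Coset.order (integer_mod_group 2 \<times>\<times> integer_mod_group 2) = 4"
    by (simp add: Coset.order_def DirProd_def carrier_integer_mod_group card_cartesian_product)
  moreover have "Coset.order (integer_mod_group 4) = 4"
    by (simp add: Coset.order_def carrier_integer_mod_group)
  ultimately show ?thesis using no abelian_integer_mod_group by metis
qed

end
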